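(* Let $\mathbb{F}$ be an algebraically closed field of characteristic $p\ge 0$ and let $A$ be an infinite (countable) dimensional simple locally finite associative algebra over $\mathbb{F}$. Then $A$ has a conical local system of arbitrarily large rank; that is, for every positive integer $N$ there is a conical local system of $A$ whose rank is at least $N$.
   Context: Algebras are associative and not required to have an identity element; ideals are two-sided. An algebra $A$ over $\mathbb{F}$ is locally finite if every finite set of elements of $A$ is contained in a finite dimensional subalgebra of $A$. A local system for $A$ is a system $\{A_\alpha\}_{\alpha\in\Gamma}$ of finite dimensional subalgebras of $A$ such that $A=\bigcup_{\alpha\in\Gamma}A_\alpha$ and for all $\alpha,\beta\in\Gamma$ there is $\gamma\in\Gamma$ with $A_\alpha,A_\beta\subseteq A_\gamma$; one writes $\alpha\le\beta$ if $A_\alpha\subseteq A_\beta$. An algebra $B$ is perfect if $BB=B$ ($BB$ being the linear span of all products of two elements of $B$); a local system is perfect if all its members are perfect. For a finite dimensional perfect algebra $B$ with (nilpotent) radical $\operatorname{rad}B$, write $B/\operatorname{rad}B=S_1\oplus\dots\oplus S_n$ with simple components $S_i\cong M_{n_i}(\mathbb{F})$. A natural $B$-module is a module obtained from the natural $n_i$-dimensional module $\mathbb{F}^{n_i}$ of some $S_i$ by letting $B$ act through the projection $B\to B/\operatorname{rad}B\to S_i$. The rank of $M_m(\mathbb{F})$ is $m$; the rank of a perfect finite dimensional algebra $B$ is the smallest rank of the simple components of $B/\operatorname{rad}B$. A perfect local system $\{A_\alpha\}_{\alpha\in\Gamma}$ of $A$ is conical if $\Gamma$ contains a minimal element $1$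 such that: (1) $A_1\subseteq A_\alpha$ for all $\alpha\in\Gamma$; (2) $A_1$ is simple; (3) for each $\alpha\in\Gamma$ the restriction of any natural $A_\alpha$-module to $A_1$ has a non-trivial composition factor (i.e. a composition factor on which $A_1$ does not act as zero). The rank of a conical local system is the rank of the algebra $A_1$. *)

theory Defs
  imports
    "HOL-Computational_Algebra.Computational_Algebra"
    "HOL-Library.Countable_Set"
    "Jordan_Normal_Form.Matrix"
begin

section \<open>Algebras on a carrier set\<close>

text \<open>
  Subalgebras, quotient algebras and matrix algebras live on different sets and types, so they are
  all presented as values of one record. No identity element is part of the structure.
\<close>

record ('f, 'a) alg =
  alg_carrier :: "'a set"
  alg_add :: "'a \<Rightarrow> 'a \<Rightarrow> 'a"
  alg_mult :: "'a \<Rightarrow> 'a \<Rightarrow> 'a"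
  alg_zero :: "'a"
  alg_scale :: "'f \<Rightarrow> 'a \<Rightarrow> 'a"

definition alg_ideal :: "('f, 'a) alg \<Rightarrow> 'a set \<Rightarrow> bool" where
  "alg_ideal Q I \<longleftrightarrow>
     I \<subseteq> alg_carrier Q \<and> alg_zero Q \<in> I \<and>
     (\<forall>x\<in>I. \<forall>y\<in>I. alg_add Q x y \<in> I) \<and>
     (\<forall>c. \<forall>x\<in>I. alg_scale Q c x \<in> I) \<and>
     (\<forall>q\<in>alg_carrier Q. \<forall>x\<in>I. alg_mult Q q x \<in> I \<and> alg_mult Q x q \<in> I)"

text \<open>
  As usual for algebras without identity, an algebra with zero multiplication is not simple;
  the first conjunct also excludes the zero algebra.
\<close>

definition alg_simple :: "('f, 'a) alg \<Rightarrow> bool" where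
  "alg_simple Q \<longleftrightarrow>
     (\<exists>x\<in>alg_carrier Q. \<exists>y\<in>alg_carrier Q. alg_mult Q x y \<noteq> alg_zero Q) \<and>
     (\<forall>I. alg_ideal Q I \<longrightarrow> I = {alg_zero Q} \<or> I = alg_carrier Q)"

definition alg_iso :: "('f, 'a) alg \<Rightarrow> ('f, 'b) alg \<Rightarrow> ('a \<Rightarrow> 'b) \<Rightarrow> bool" where
  "alg_iso P Q \<phi> \<longleftrightarrow>
     bij_betw \<phi> (alg_carrier P) (alg_carrier Q) \<and>
     (\<forall>x\<in>alg_carrier P. \<forall>y\<in>alg_carrier P.
        \<phi> (alg_add P x y) = alg_add Q (\<phi> x) (\<phi> y) \<and>
        \<phi> (alg_mult P x y) = alg_mult Q (\<phi> x) (\<phi> y)) \<and>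
     (\<forall>c. \<forall>x\<in>alg_carrier P. \<phi> (alg_scale P c x) = alg_scale Q c (\<phi> x))"

definition mat_alg :: "nat \<Rightarrow> ('f::field, 'f mat) alg" where
  "mat_alg n =
     \<lparr>alg_carrier = carrier_mat n n, alg_add = (+), alg_mult = (*), alg_zero = 0\<^sub>m n n,
      alg_scale = (\<cdot>\<^sub>m)\<rparr>"

text \<open>
  The list \<open>ss\<close> consists of the components of \<open>q\<close> with respect to the list of subspaces \<open>Ss\<close>.
\<close>

definition alg_components :: "('f, 'a) alg \<Rightarrow> 'a set list \<Rightarrow> 'a \<Rightarrow> 'a list \<Rightarrow> bool" where
  "alg_components Q Ss q ss \<longleftrightarrow>
     length ss = length Ss \<and> (\<forall>i<length Ss. ss ! i \<in> Ss ! i) \<and>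
     q = foldr (alg_add Q) ss (alg_zero Q)"

definition simple_decomposition :: "('f, 'a) alg \<Rightarrow> 'a set list \<Rightarrow> bool" where
  "simple_decomposition Q Ss \<longleftrightarrow>
     (\<forall>S\<in>set Ss. alg_ideal Q S \<and> alg_simple (Q\<lparr>alg_carrier := S\<rparr>)) \<and>
     (\<forall>q\<in>alg_carrier Q. \<exists>!ss. alg_components Q Ss q ss)"

definition alg_proj :: "('f, 'a) alg \<Rightarrow> 'a set list \<Rightarrow> nat \<Rightarrow> 'a \<Rightarrow> 'a" where
  "alg_proj Q Ss i q = (THE ss. alg_components Q Ss q ss) ! i"

section \<open>Modules given by a matrix representation\<close>

text \<open>
  Here \<open>C\<close> acts on the column space of dimension \<open>n\<close> by \<open>c \<cdot> v = \<rho> c *\<^sub>v v\<close>. The set \<open>C\<close>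
  may be smaller than the algebra on which \<open>\<rho>\<close> is a representation; this is restriction.
\<close>

definition rep_submodule :: "'a set \<Rightarrow> nat \<Rightarrow> ('a \<Rightarrow> 'f::field mat) \<Rightarrow> 'f vec set \<Rightarrow> bool" where
  "rep_submodule C n \<rho> W \<longleftrightarrow>
     W \<subseteq> carrier_vec n \<and> 0\<^sub>v n \<in> W \<and>
     (\<forall>v\<in>W. \<forall>w\<in>W. v + w \<in> W) \<and>
     (\<forall>k. \<forall>w\<in>W. k \<cdot>\<^sub>v w \<in> W) \<and>
     (\<forall>c\<in>C. \<forall>w\<in>W. \<rho> c *\<^sub>v w \<in> W)"

definition composition_series ::
    "'a set \<Rightarrow> nat \<Rightarrow> ('a \<Rightarrow> 'f::field mat) \<Rightarrow> 'f vec set list \<Rightarrow> bool" where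
  "composition_series C n \<rho> Ws \<longleftrightarrow>
     Ws \<noteq> [] \<and> hd Ws = {0\<^sub>v n} \<and> last Ws = carrier_vec n \<and>
     (\<forall>W\<in>set Ws. rep_submodule C n \<rho> W) \<and>
     (\<forall>i. Suc i < length Ws \<longrightarrow>
        Ws ! i \<subset> Ws ! Suc i \<and>
        \<not> (\<exists>U. rep_submodule C n \<rho> U \<and> Ws ! i \<subset> U \<and> U \<subset> Ws ! Suc i))"

text \<open>
  \<open>C\<close> acts as zero on the factor \<open>Ws ! Suc i / Ws ! i\<close> iff it maps \<open>Ws ! Suc i\<close> into \<open>Ws ! i\<close>.
\<close>

definition has_nontrivial_factor :: "'a set \<Rightarrow> nat \<Rightarrow> ('a \<Rightarrow> 'f::field mat) \<Rightarrow> bool" where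
  "has_nontrivial_factor C n \<rho> \<longleftrightarrow>
     (\<exists>Ws i. composition_series C n \<rho> Ws \<and> Suc i < length Ws \<and>
        (\<exists>c\<in>C. \<exists>w\<in>Ws ! Suc i. \<rho> c *\<^sub>v w \<notin> Ws ! i))"

section \<open>Associative algebras and their subalgebras\<close>

text \<open>
  The class \<open>ring\<close> does not require an identity element. The algebra is the whole type \<open>'a\<close>.
\<close>

locale assoc_algebra = vector_space scale
  for scale :: "'f::field \<Rightarrow> 'a::ring \<Rightarrow> 'a" (infixr \<open>*s\<close> 75) +
  assumes scale_mult_left: "(c *s x) * y = c *s (x * y)"
    and scale_mult_right: "x * (c *s y) = c *s (x * y)"
begin

definition sub_alg :: "'a set \<Rightarrow> ('f, 'a) alg" where
  "sub_alg B =
     \<lparr>alg_carrier = B, alg_add = (+), alg_mult = (*), alg_zero = 0, alg_scale = (*s)\<rparr>"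

definition subalgebra :: "'a set \<Rightarrow> bool" where
  "subalgebra B \<longleftrightarrow> subspace B \<and> (\<forall>x\<in>B. \<forall>y\<in>B. x * y \<in> B)"

definition fin_dim :: "'a set \<Rightarrow> bool" where
  "fin_dim B \<longleftrightarrow> (\<exists>X. finite X \<and> span X = B)"

definition countably_infinite_dim :: bool where
  "countably_infinite_dim \<longleftrightarrow>
     (\<exists>X. infinite X \<and> countable X \<and> independent X \<and> span X = UNIV)"

definition locally_finite :: bool where
  "locally_finite \<longleftrightarrow>
     (\<forall>X. finite X \<longrightarrow> (\<exists>B. subalgebra B \<and> fin_dim B \<and> X \<subseteq> B))"

definition set_prod :: "'a set \<Rightarrow> 'a set \<Rightarrow> 'a set" where
  "set_prod X Y = span {x * y | x y. x \<in> X \<and> y \<in> Y}"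

definition perfect :: "'a set \<Rightarrow> bool" where
  "perfect B \<longleftrightarrow> set_prod B B = B"

text \<open>\<open>set_pow I k\<close> is the power of \<open>I\<close> with exponent \<open>k + 1\<close>.\<close>

primrec set_pow :: "'a set \<Rightarrow> nat \<Rightarrow> 'a set" where
  "set_pow I 0 = I"
| "set_pow I (Suc k) = set_prod I (set_pow I k)"

definition nilpotent_set :: "'a set \<Rightarrow> bool" where
  "nilpotent_set I \<longleftrightarrow> (\<exists>k. set_pow I k = {0})"

text \<open>
  The sum of all nilpotent ideals of \<open>B\<close>; for finite dimensional \<open>B\<close> this is the largest
  nilpotent ideal.
\<close>

definition radical :: "'a set \<Rightarrow> 'a set" where
  "radical B = span (\<Union>{I. alg_ideal (sub_alg B) I \<and> nilpotent_set I})"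

definition coset :: "'a set \<Rightarrow> 'a \<Rightarrow> 'a set" where
  "coset R x = (\<lambda>r. x + r) ` R"

definition quot_alg :: "'a set \<Rightarrow> 'a set \<Rightarrow> ('f, 'a set) alg" where
  "quot_alg B R =
     \<lparr>alg_carrier = coset R ` B,
      alg_add = (\<lambda>X Y. \<Union>x\<in>X. \<Union>y\<in>Y. coset R (x + y)),
      alg_mult = (\<lambda>X Y. \<Union>x\<in>X. \<Union>y\<in>Y. coset R (x * y)),
      alg_zero = R,
      alg_scale = (\<lambda>c X. \<Union>x\<in>X. coset R (c *s x))\<rparr>"

abbreviation semisimple_quot :: "'a set \<Rightarrow> ('f, 'a set) alg" where
  "semisimple_quot B \<equiv> quot_alg B (radical B)"

text \<open>
  The natural module of the simple component \<open>Ss ! i\<close> is the column space on which it acts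
  through an isomorphism \<open>\<phi>\<close> with a full matrix algebra, and \<open>B\<close> acts through the projection
  onto that component. All isomorphisms \<open>\<phi>\<close> are allowed.
\<close>

definition natural_module :: "'a set \<Rightarrow> nat \<Rightarrow> ('a \<Rightarrow> 'f mat) \<Rightarrow> bool" where
  "natural_module B n \<rho> \<longleftrightarrow>
     (\<exists>Ss i \<phi>. simple_decomposition (semisimple_quot B) Ss \<and> i < length Ss \<and>
        alg_iso ((semisimple_quot B)\<lparr>alg_carrier := Ss ! i\<rparr>) (mat_alg n) \<phi> \<and>
        (\<forall>b\<in>B. \<rho> b = \<phi> (alg_proj (semisimple_quot B) Ss i (coset (radical B) b))))"

text \<open>
  The infimum is the minimum when the set is nonempty, and \<open>Inf {} = 0\<close> otherwise. The latter does
  not occur for nonzero finite dimensional perfect \<open>B\<close> over an algebraically closed field.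
\<close>

definition rank :: "'a set \<Rightarrow> nat" where
  "rank B =
     Inf {m. \<exists>Ss S \<phi>. simple_decomposition (semisimple_quot B) Ss \<and> S \<in> set Ss \<and>
                alg_iso ((semisimple_quot B)\<lparr>alg_carrier := S\<rparr>) (mat_alg m) \<phi>}"

definition local_system :: "'i set \<Rightarrow> ('i \<Rightarrow> 'a set) \<Rightarrow> bool" where
  "local_system \<Gamma> \<A> \<longleftrightarrow>
     (\<forall>\<alpha>\<in>\<Gamma>. subalgebra (\<A> \<alpha>) \<and> fin_dim (\<A> \<alpha>)) \<and>
     (\<Union>\<alpha>\<in>\<Gamma>. \<A> \<alpha>) = UNIV \<and>
     (\<forall>\<alpha>\<in>\<Gamma>. \<forall>\<beta>\<in>\<Gamma>. \<exists>\<gamma>\<in>\<Gamma>. \<A> \<alpha> \<subseteq> \<A> \<gamma> \<and> \<A> \<beta> \<subseteq> \<A> \<gamma>)"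

definition perfect_local_system :: "'i set \<Rightarrow> ('i \<Rightarrow> 'a set) \<Rightarrow> bool" where
  "perfect_local_system \<Gamma> \<A> \<longleftrightarrow> local_system \<Gamma> \<A> \<and> (\<forall>\<alpha>\<in>\<Gamma>. perfect (\<A> \<alpha>))"

text \<open>
  The index \<open>e\<close> is the distinguished minimal element of \<open>\<Gamma>\<close>. The order on \<open>\<Gamma>\<close> is inclusion of
  the subalgebras, so its minimality is part of the condition \<open>\<A> e \<subseteq> \<A> \<alpha>\<close>.
\<close>

definition conical_local_system :: "'i set \<Rightarrow> ('i \<Rightarrow> 'a set) \<Rightarrow> 'i \<Rightarrow> bool" where
  "conical_local_system \<Gamma> \<A> e \<longleftrightarrow>
     perfect_local_system \<Gamma> \<A> \<and> e \<in> \<Gamma> \<and>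
     (\<forall>\<alpha>\<in>\<Gamma>. \<A> e \<subseteq> \<A> \<alpha>) \<and>
     alg_simple (sub_alg (\<A> e)) \<and>
     (\<forall>\<alpha>\<in>\<Gamma>. \<forall>n \<rho>. natural_module (\<A> \<alpha>) n \<rho> \<longrightarrow> has_nontrivial_factor (\<A> e) n \<rho>)"

definition conical_rank :: "('i \<Rightarrow> 'a set) \<Rightarrow> 'i \<Rightarrow> nat" where
  "conical_rank \<A> e = rank (\<A> e)"

end

end

theory Submission
  imports Defs "Jordan_Normal_Form.Determinant"
begin

text \<open>
  If \<open>e\<close> is the first diagonal unit of a matrix subalgebra \<open>S\<close> of \<open>A\<close>, then the spans of \<open>B e B\<close>, with
  \<open>B\<close> running over the finite dimensional subalgebras containing \<open>S\<close>, form a conical local system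
  with minimal member \<open>S\<close>: they are perfect because \<open>b e c = (b e) (e c)\<close>, they exhaust \<open>A = A e A\<close>,
  and a natural module on which \<open>e\<close> acts as zero would be annihilated by all of \<open>B e B\<close>.

  So it remains to find matrix units of arbitrary size. Every nonzero \<open>a \<in> A\<close> has a non-nilpotent
  right multiple, since otherwise \<open>A\<close> would be locally nilpotent and not simple; and a non-nilpotent
  element has an idempotent multiple. If some corner \<open>h A h\<close> with \<open>h = h\<^sup>2 \<noteq> 0\<close> has only the
  idempotents \<open>0\<close> and \<open>h\<close>, it is algebraic over \<open>F\<close> and a division algebra, hence equal to \<open>F h\<close>,
  and matrix units of any size are obtained from dual bases for the pairing \<open>h A \<times> A h \<rightarrow> F h\<close>.
  Otherwise every nonzero idempotent \<open>h\<close> splits as \<open>g + f\<close>, and a non-nilpotent product in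
  \<open>(g A f) (f A g)\<close> yields equivalent nonzero idempotents below \<open>g\<close> and \<open>f\<close>, which enlarges a
  given system of matrix units.
\<close>

section \<open>Finite dimensional subalgebras and idempotents\<close>

context assoc_algebra
begin

section \<open>Subspaces, descending chains and products of sets\<close>

lemma subalgebraD:
  assumes "subalgebra B"
  shows "subspace B" "\<And>x y. x \<in> B \<Longrightarrow> y \<in> B \<Longrightarrow> x * y \<in> B"
  using assms by (auto simp: subalgebra_def)

text \<open>A basis of \<open>U\<close> stays independent when a vector of \<open>V\<close> outside
  \<open>U\<close> is added. The finite spanning set \<open>X\<close> makes a basis of
  \<open>V\<close> finite, so that the cardinalities can be compared strictly.\<close>

lemma strict_subspace_dim:
  assumes "subspace U" "subspace V" "U \<subset> V" "finite X" "V \<subseteq> span X"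
  shows "dim U < dim V"
proof -
  obtain BU where BU: "BU \<subseteq> U" "independent BU" "U \<subseteq> span BU" "card BU = dim U"
    by (rule basis_exists)
  obtain BV where BV: "BV \<subseteq> V" "independent BV" "V \<subseteq> span BV" "card BV = dim V"
    by (rule basis_exists)
  obtain x where x: "x \<in> V" "x \<notin> U" using assms by blast
  have finV: "finite BV"
    using independent_span_bound[of X BV] BV assms by blast
  have "span BU \<subseteq> U" using BU assms by (simp add: span_minimal)
  with x have xs: "x \<notin> span BU" by blast
  with BU have ind: "independent (insert x BU)" by (simp add: independent_insertI)
  have "insert x BU \<subseteq> span BV" using BU BV x assms by blast
  from independent_span_bound[OF finV ind this] have fin: "finite (insert x BU)"
    and card: "card (insert x BU) \<le> card BV" by auto
  have "x \<notin> BU" using xs span_base by blast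
  then show ?thesis using fin card BU BV by simp
qed

text \<open>The descending chain condition, obtained by minimizing \<open>dim\<close>. It supplies
  the stable power and the minimal \<open>R x\<close> for nil subalgebras, and the stable polynomial
  multiples behind idempotents.\<close>

lemma fin_dim_minimal_subspace:
  assumes "fin_dim B" "i \<in> I" "\<And>i. i \<in> I \<Longrightarrow> subspace (U i)" "\<And>i. i \<in> I \<Longrightarrow> U i \<subseteq> B"
  obtains k where "k \<in> I" "\<And>j. j \<in> I \<Longrightarrow> U j \<subseteq> U k \<Longrightarrow> U j = U k"
proof -
  obtain X where X: "finite X" "span X = B" using assms by (auto simp: fin_dim_def)
  obtain k where k: "k \<in> I" "\<And>j. j \<in> I \<Longrightarrow> dim (U k) \<le> dim (U j)"
    using ex_has_least_nat[of "\<lambda>j. j \<in> I" i "\<lambda>j. dim (U j)"] assms(2) by blast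
  have "U j = U k" if j: "j \<in> I" "U j \<subseteq> U k" for j
  proof (rule ccontr)
    assume "U j \<noteq> U k"
    then have "dim (U j) < dim (U k)"
      using strict_subspace_dim[of "U j" "U k" X] j k(1) assms(3,4) X by blast
    with k(2)[OF j(1)] show False by simp
  qed
  with k(1) show thesis by (rule that)
qed

lemma fin_dim_mono:
  assumes "fin_dim B" "subspace U" "U \<subseteq> B"
  shows "fin_dim U"
proof -
  obtain X where X: "finite X" "span X = B" using assms by (auto simp: fin_dim_def)
  obtain C where C: "C \<subseteq> U" "independent C" "U \<subseteq> span C" "card C = dim U"
    by (rule basis_exists)
  have "finite C" using independent_span_bound[of X C] C X assms by auto
  moreover have "span C = U" using C assms(2) by (simp add: span_minimal subset_antisym)
  ultimately show ?thesis by (auto simp: fin_dim_def)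
qed

lemma subspace_mult_left: "subspace U \<Longrightarrow> subspace ((\<lambda>u. x * u) ` U)"
  by (auto simp: subspace_def image_iff simp flip: distrib_left scale_mult_right
      intro: bexI[of _ 0])

lemma subspace_mult_right: "subspace U \<Longrightarrow> subspace ((\<lambda>u. u * x) ` U)"
  by (auto simp: subspace_def image_iff simp flip: distrib_right scale_mult_left
      intro: bexI[of _ 0])

lemma span_mult:
  assumes "x \<in> span X" "y \<in> span Y"
  shows "x * y \<in> set_prod X Y"
proof -
  have 1: "a * y \<in> set_prod X Y" if "a \<in> X" for a
    using assms(2)
  proof (induction y rule: span_induct_alt)
    case base then show ?case by (simp add: set_prod_def span_zero)
  next
    case (step c z w)
    then have "a * z \<in> set_prod X Y" using that by (auto simp: set_prod_def intro: span_base)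
    with step show ?case
      by (simp add: set_prod_def distrib_left scale_mult_right span_add span_scale)
  qed
  show ?thesis using assms(1)
  proof (induction x rule: span_induct_alt)
    case base then show ?case by (simp add: set_prod_def span_zero)
  next
    case (step c z w)
    then show ?case using 1[of z]
      by (simp add: set_prod_def distrib_right scale_mult_left span_add span_scale)
  qed
qed

lemma subspace_set_prod: "subspace (set_prod X Y)"
  by (simp add: set_prod_def)

lemma set_prodI: "x \<in> X \<Longrightarrow> y \<in> Y \<Longrightarrow> x * y \<in> set_prod X Y"
  by (auto simp: set_prod_def intro: span_base)

lemma set_prod_minimal:
  assumes "subspace U" "\<And>x y. x \<in> X \<Longrightarrow> y \<in> Y \<Longrightarrow> x * y \<in> U"
  shows "set_prod X Y \<subseteq> U"
  unfolding set_prod_def by (rule span_minimal) (use assms in auto)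

text \<open>\<open>dpow C k\<close> is the power of \<open>C\<close> with exponent \<open>2 ^ k\<close>; doubling makes a stable term idempotent.\<close>

primrec dpow :: "'a set \<Rightarrow> nat \<Rightarrow> 'a set" where
  "dpow C 0 = C"
| "dpow C (Suc k) = set_prod (dpow C k) (dpow C k)"

lemma dpow_decreasing:
  assumes "subalgebra C"
  shows "subspace (dpow C k)" "dpow C (Suc k) \<subseteq> dpow C k" "dpow C k \<subseteq> C"
proof -
  have 1: "subspace (dpow C k)" for k
    using assms by (cases k) (auto simp: subspace_set_prod subalgebraD)
  have 2: "dpow C (Suc k) \<subseteq> dpow C k" for k
  proof (induction k)
    case 0 show ?case using set_prod_minimal[of C C C] assms by (simp add: subalgebraD)
  next
    case (Suc k)
    show ?case unfolding dpow.simps(2)[of C "Suc k"]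
      by (rule set_prod_minimal[OF 1]) (use Suc in \<open>simp add: set_prodI subset_iff\<close>)
  qed
  show "subspace (dpow C k)" "dpow C (Suc k) \<subseteq> dpow C k" using 1 2 by auto
  show "dpow C k \<subseteq> C" by (induction k) (use 2 in auto)
qed

section \<open>Nilpotent elements and nil subalgebras\<close>

text \<open>\<open>rpow x k\<close> is the power of \<open>x\<close> with exponent \<open>k + 1\<close>: there may be no identity.\<close>

definition rpow :: "'a \<Rightarrow> nat \<Rightarrow> 'a" where
  "rpow x k = (((*) x) ^^ k) x"

lemma rpow_simps [simp]: "rpow x 0 = x" "rpow x (Suc k) = x * rpow x k"
  by (simp_all add: rpow_def)

definition nil :: "'a \<Rightarrow> bool" where
  "nil x \<longleftrightarrow> (\<exists>k. rpow x k = 0)"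

lemma nil_square: "nil (x * x) \<Longrightarrow> nil x"
proof -
  \<comment> \<open>With the exponent shift of \<open>rpow\<close>, both sides are x^(2k+2).\<close>
  have "rpow (x * x) k = rpow x (Suc (2 * k))" for k
    by (induction k) (auto simp: mult.assoc)
  then show "nil (x * x) \<Longrightarrow> nil x" by (metis nil_def)
qed

lemma nil_fixed_vector:
  assumes "y = t * y" "nil t"
  shows "y = 0"
proof -
  have "rpow t k * y = y" for k
    by (induction k) (use assms(1) in \<open>auto simp: mult.assoc\<close>)
  with assms(2) show ?thesis by (metis mult_zero_left nil_def)
qed

text \<open>
  If the powers of \<open>C\<close> stabilize at \<open>R = R R \<noteq> {0}\<close>, a minimal nonzero \<open>R x\<close> contains some \<open>y\<close>
  with \<open>R y = R x\<close>, hence \<open>y = t y\<close> with \<open>t \<in> R\<close>, which is not nilpotent.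
\<close>

lemma nil_subalgebra_nilpotent:
  assumes C: "subalgebra C" "fin_dim C" and nil: "\<And>x. x \<in> C \<Longrightarrow> nil x"
  shows "\<exists>k. dpow C k = {0}"
proof -
  obtain k where min: "\<And>j. dpow C j \<subseteq> dpow C k \<Longrightarrow> dpow C j = dpow C k"
    using fin_dim_minimal_subspace[OF C(2), of 0 UNIV "dpow C"] dpow_decreasing(1,3)[OF C(1)]
    by (metis UNIV_I)
  define R where k: "R = dpow C k"
  have RR: "set_prod R R = R"
    using min[of "Suc k"] dpow_decreasing(2)[OF C(1)] k by simp
  have R: "subspace R" "R \<subseteq> C" using k dpow_decreasing C by auto
  have Rmult: "r * s \<in> R" if "r \<in> R" "s \<in> R" for r s using RR that set_prodI by blast
  have "R = {0}"
  proof (rule ccontr)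
    assume ne: "R \<noteq> {0}"
    \<comment> \<open>The candidates for a minimal nonzero \<open>R x\<close>: those
      \<open>x\<close> for which \<open>R x\<close> does not vanish.\<close>
    define I where "I = {x \<in> R. \<exists>r\<in>R. r * x \<noteq> 0}"
    define U where "U x = (\<lambda>r. r * x) ` R" for x
    have "I \<noteq> {}"
    proof
      assume "I = {}"
      then have "r * x \<in> {0}" if "x \<in> R" "r \<in> R" for x r using that I_def by blast
      then have "set_prod R R \<subseteq> {0}" by (intro set_prod_minimal) auto
      with RR ne R(1) show False using subspace_0 by blast
    qed
    then obtain i where i: "i \<in> I" by blast
    have "subspace (U x)" "x \<in> I \<Longrightarrow> U x \<subseteq> C" for x
      using R Rmult unfolding U_def I_def by (auto intro!: subspace_mult_right)
    then obtain x where "x \<in> I" and U: "\<And>y. y \<in> I \<Longrightarrow> U y \<subseteq> U x \<Longrightarrow> U y = U x"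
      using fin_dim_minimal_subspace[OF C(2) i, of U] by blast
    then have x: "x \<in> R" "\<exists>r\<in>R. r * x \<noteq> 0"
      unfolding I_def by blast+
    \<comment> \<open>Since \<open>R R = R\<close>, an \<open>R x\<close> annihilated by
      \<open>R\<close> would already be zero.\<close>
    have "\<exists>s\<in>R. \<exists>r\<in>R. s * (r * x) \<noteq> 0"
    proof (rule ccontr)
      assume neg: "\<not> ?thesis"
      have "set_prod R R \<subseteq> {u. u * x = 0}"
        using neg by (intro set_prod_minimal)
          (auto simp: mult.assoc subspace_def distrib_right scale_mult_left)
      with RR x(2) show False by blast
    qed
    then obtain s r where sr: "s \<in> R" "r \<in> R" "s * (r * x) \<noteq> 0" by blast
    define y where "y = r * x"
    have "U y = U x"
    proof (rule U)
      show "y \<in> I" unfolding I_def using sr y_def Rmult x(1) by blast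
      show "U y \<subseteq> U x" unfolding U_def y_def using Rmult sr(2)
        by (auto simp flip: mult.assoc)
    qed
    then have "y \<in> U y" using sr(2) by (simp add: y_def U_def)
    then obtain t where t: "t \<in> R" "y = t * y" unfolding U_def by blast
    then have "y = 0" using nil_fixed_vector[of y t] nil R by blast
    with sr y_def show False by simp
  qed
  with k show ?thesis by blast
qed

section \<open>Polynomials in one element and idempotent multiples\<close>

text \<open>\<open>pev x m p\<close> is \<open>p(x) m\<close>, which makes sense without an identity.\<close>

definition pev :: "'a \<Rightarrow> 'a \<Rightarrow> 'f poly \<Rightarrow> 'a" where
  "pev x m p = fold_coeffs (\<lambda>c u. c *s m + x * u) p 0"

lemma pev_pCons [simp]: "pev x m (pCons c p) = c *s m + x * pev x m p"
  by (cases "c = 0 \<and> p = 0")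
    (auto simp: pev_def fold_coeffs_pCons_coeff_not_0_eq fold_coeffs_pCons_not_0_0_eq)

lemma pev_0 [simp]: "pev x m 0 = 0"
  by (simp add: pev_def)

lemma pev_add: "pev x m (p + q) = pev x m p + pev x m q"
  by (induction p q rule: poly_induct2) (auto simp: algebra_simps scale_left_distrib)

lemma pev_smult: "pev x m (Polynomial.smult c p) = c *s pev x m p"
  by (induction p) (auto simp: scale_right_distrib scale_mult_right)

lemma pev_diff: "pev x m (p - q) = pev x m p - pev x m q"
  using pev_add[of x m "p - q" q] by simp

lemma pev_mult: "pev x m (p * q) = pev x (pev x m q) p"
  by (induction p) (auto simp: pev_add pev_smult)

lemma pev_times: "pev x m p * u = pev x (m * u) p"
  by (induction p) (auto simp: distrib_right scale_mult_left mult.assoc)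

lemma pev_in_subalgebra:
  assumes "subalgebra B" "x \<in> B" "m \<in> B"
  shows "pev x m p \<in> B"
  using assms subalgebraD(1)[THEN subspace_add] subalgebraD(1)[THEN subspace_scale]
    subalgebraD(1)[THEN subspace_0] by (induction p) (auto simp: subalgebraD)

lemma subspace_pev: "subspace {pev x m (r * q) | q. True}"
  unfolding subspace_def
proof (intro conjI ballI allI)
  show "0 \<in> {pev x m (r * q) | q. True}" by (auto intro!: exI[of _ 0])
next
  fix a b assume "a \<in> {pev x m (r * q) | q. True}" "b \<in> {pev x m (r * q) | q. True}"
  then obtain q q' where "a = pev x m (r * q)" "b = pev x m (r * q')" by blast
  then have "a + b = pev x m (r * (q + q'))" by (simp add: pev_add distrib_left)
  then show "a + b \<in> {pev x m (r * q) | q. True}" by blast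
next
  fix c a assume "a \<in> {pev x m (r * q) | q. True}"
  then obtain q where "a = pev x m (r * q)" by blast
  then have "c *s a = pev x m (r * Polynomial.smult c q)" by (simp add: pev_smult)
  then show "c *s a \<in> {pev x m (r * q) | q. True}" by blast
qed

text \<open>The values p(x) m, with p a multiple of X^k, form subspaces that decrease as k grows. At
  a minimal one, X^k may be traded for a multiple of any higher power of X.\<close>

lemma pev_stabilizes:
  assumes "subalgebra B" "fin_dim B" "x \<in> B" "m \<in> B"
  obtains k where "\<And>j. j \<ge> k \<Longrightarrow> \<exists>q. pev x m (monom 1 k) = pev x m (monom 1 j * q)"
proof -
  define U where "U k = {pev x m (monom 1 k * q) | q. True}" for k
  have "subspace (U j)" "U j \<subseteq> B" for j
    using subspace_pev pev_in_subalgebra[OF assms(1,3,4)] unfolding U_def by auto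
  then obtain k where k: "\<And>j. U j \<subseteq> U k \<Longrightarrow> U j = U k"
    using fin_dim_minimal_subspace[OF assms(2), of 0 UNIV U] by (metis UNIV_I)
  have sub: "U j \<subseteq> U k" if "j \<ge> k" for j
  proof
    fix a assume "a \<in> U j"
    then obtain q where "a = pev x m (monom 1 j * q)" unfolding U_def by blast
    moreover have "monom (1::'f) j = monom 1 k * monom 1 (j - k)"
      using that by (simp add: mult_monom)
    ultimately have "a = pev x m (monom 1 k * (monom 1 (j - k) * q))" by (simp add: mult.assoc)
    then show "a \<in> U k" unfolding U_def by blast
  qed
  show thesis
  proof
    fix j assume "j \<ge> k"
    then have "U j = U k" using k sub by blast
    moreover have "pev x m (monom 1 k) \<in> U k" unfolding U_def by (auto intro!: exI[of _ 1])
    ultimately show "\<exists>q. pev x m (monom 1 k) = pev x m (monom 1 j * q)" unfolding U_def by blast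
  qed
qed

lemma rpow_pev: "rpow x k = pev x x (monom 1 k)"
  by (induction k) (auto simp: monom_0 monom_Suc)

text \<open>\<open>pev x x p\<close> is the value of X p at x, so a product of two such values
  contains one further X; \<open>pCons 0\<close> supplies it.\<close>

lemma pev_self_mult: "pev x x p * pev x x q = pev x x (pCons 0 (p * q))"
proof -
  have "pev x x p * pev x x q = pev x (pev x x (pCons 0 q)) p"
    by (simp add: pev_times)
  also have "\<dots> = pev x x (pCons 0 (p * q))" by (simp only: pev_mult[symmetric]) simp
  finally show ?thesis .
qed

text \<open>A Fitting argument. Stabilization gives x^(k+1) = x^(2k+3) q(x). For d = x^(k+1) q(x)
  the element x d is then idempotent, and it fixes the nonzero element x^(k+1).\<close>

lemma idempotent_of_non_nil:
  assumes "subalgebra B" "fin_dim B" "x \<in> B" "\<not> nil x"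
  obtains d where "x * d = d * x" "(x * d) * (x * d) = x * d" "x * d \<noteq> 0"
proof -
  obtain k where k: "\<And>j. j \<ge> k \<Longrightarrow> \<exists>q. pev x x (monom 1 k) = pev x x (monom 1 j * q)"
    using pev_stabilizes[OF assms(1-3,3)] by blast
  \<comment> \<open>The exponent is chosen to match \<open>(x * d) * rpow x k\<close>, so that this
    one equation yields both idempotency and nonvanishing.\<close>
  obtain q where q: "pev x x (monom 1 k) = pev x x (monom 1 (2 * k + 2) * q)"
    using k[of "2 * k + 2"] by auto
  define d where "d = pev x x (monom 1 k * q)"
  have m2: "monom (1::'f) (2 * k + 2) = monom 1 1 * (monom 1 1 * (monom 1 k * monom 1 k))"
    by (simp add: mult_monom mult_2)
  have X: "pCons 0 p = monom 1 1 * p" for p :: "'f poly"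
    by (simp add: monom_Suc monom_0)
  have xd: "x * d = pev x x (monom 1 1 * (monom 1 k * q))" unfolding d_def
    by (metis X pev_pCons scale_zero_left add_0)
  \<comment> \<open>The equation for \<open>q\<close> multiplied on the right by r(x) x; the case
    \<open>r = q\<close> gives idempotency.\<close>
  have shift: "pev x x (pCons 0 (monom 1 k * r)) = pev x x (pCons 0 (monom 1 (2 * k + 2) * q * r))"
    for r
    using arg_cong[OF q, of "\<lambda>u. u * pev x x r"] by (simp only: pev_self_mult)
  have sq: "(x * d) * (x * d) = x * d"
  proof -
    have "(x * d) * (x * d) = pev x x (pCons 0 (monom 1 (2 * k + 2) * q * q))"
      unfolding xd pev_self_mult m2 by (simp only: mult_ac)
    also have "\<dots> = x * d" using shift[of q] xd by (simp only: X)
    finally show ?thesis .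
  qed
  have "x * d = d * x"
    using pev_self_mult[of x 1 "monom 1 k * q"] pev_self_mult[of x "monom 1 k * q" 1]
    by (simp add: d_def one_pCons)
  moreover have "x * d \<noteq> 0"
  proof
    assume "x * d = 0"
    then have "(x * d) * pev x x (monom 1 k) = 0" by simp
    then have "pev x x (monom 1 (2 * k + 2) * q) = 0"
      unfolding xd pev_self_mult m2 X by (simp only: mult_ac)
    with q assms(4) show False by (metis nil_def rpow_pev)
  qed
  ultimately show thesis using that sq by blast
qed

end

section \<open>Simple locally finite algebras\<close>

locale simple_locally_finite_algebra = assoc_algebra scale
  for scale :: "'f::field \<Rightarrow> 'a::ring \<Rightarrow> 'a" (infixr \<open>*s\<close> 75) +
  assumes simple: "alg_simple (sub_alg UNIV)"
    and locally_finite: "locally_finite"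
begin

section \<open>Ideals and annihilators in a simple algebra\<close>

lemma fin_dim_subalgebra_containing:
  assumes "finite X"
  obtains B where "subalgebra B" "fin_dim B" "X \<subseteq> B"
  using locally_finite assms by (auto simp: locally_finite_def)

lemma fin_dim_subalgebras_directed:
  assumes "fin_dim B" "fin_dim C"
  obtains D where "subalgebra D" "fin_dim D" "B \<subseteq> D" "C \<subseteq> D"
proof -
  obtain X Y where X: "finite X" "span X = B" and Y: "finite Y" "span Y = C"
    using assms by (auto simp: fin_dim_def)
  then obtain D where D: "subalgebra D" "fin_dim D" "X \<union> Y \<subseteq> D"
    using fin_dim_subalgebra_containing[of "X \<union> Y"] by blast
  then have "X \<subseteq> D" "Y \<subseteq> D" by auto
  then have "span X \<subseteq> D" "span Y \<subseteq> D"
    using span_minimal subalgebraD(1)[OF D(1)] by metis+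
  with X Y D that show thesis by blast
qed

lemma ideal_eq_UNIV:
  assumes "a \<noteq> 0" "a \<in> I"
    and "subspace I" "\<And>x y. x \<in> I \<Longrightarrow> y * x \<in> I" "\<And>x y. x \<in> I \<Longrightarrow> x * y \<in> I"
  shows "I = UNIV"
proof -
  have "alg_ideal (sub_alg UNIV) I"
    using assms(3-5) by (auto simp: alg_ideal_def sub_alg_def subspace_def)
  with simple have "I = {0} \<or> I = UNIV" by (auto simp: alg_simple_def sub_alg_def)
  with assms(1,2) show ?thesis by blast
qed

lemma nonzero_product: "\<exists>x y :: 'a. x * y \<noteq> 0"
  using simple by (auto simp: alg_simple_def sub_alg_def)

text \<open>The elements annihilated by all left multiplications form an ideal, which is proper
  because some product is nonzero.\<close>

lemma right_annihilator_zero: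
  fixes z :: 'a
  assumes "\<And>x. x * z = 0"
  shows "z = 0"
proof (rule ccontr)
  assume "z \<noteq> 0"
  have "{z :: 'a. \<forall>x. x * z = 0} = UNIV"
    by (rule ideal_eq_UNIV[OF \<open>z \<noteq> 0\<close>])
      (use assms in \<open>auto simp: subspace_def distrib_left scale_mult_right simp flip: mult.assoc\<close>)
  with nonzero_product show False by blast
qed

lemma left_annihilator_zero:
  fixes z :: 'a
  assumes "\<And>x. z * x = 0"
  shows "z = 0"
proof (rule ccontr)
  assume "z \<noteq> 0"
  have "{z :: 'a. \<forall>x. z * x = 0} = UNIV"
    by (rule ideal_eq_UNIV[OF \<open>z \<noteq> 0\<close>])
      (use assms in \<open>auto simp: subspace_def distrib_right scale_mult_left mult.assoc\<close>)
  with nonzero_product show False by blast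
qed

text \<open>Simple algebras are prime. If a A b = 0, the elements c with a A c = 0 form an ideal
  containing b, so a A A = 0, against the vanishing of left annihilators.\<close>

lemma nonzero_sandwich:
  fixes a b :: 'a
  assumes "a \<noteq> 0" "b \<noteq> 0"
  obtains x where "a * x * b \<noteq> 0"
proof (rule ccontr)
  assume "\<not> thesis"
  then have neg: "a * u * b = 0" for u using that by blast
  obtain y where y: "a * y \<noteq> 0" using left_annihilator_zero assms(1) by blast
  have "{c. \<forall>u v. a * u * (c * v) = 0 \<and> a * u * c = 0} = UNIV"
  proof (rule ideal_eq_UNIV[OF \<open>b \<noteq> 0\<close>])
    show "b \<in> {c. \<forall>u v. a * u * (c * v) = 0 \<and> a * u * c = 0}"
      using neg by (simp flip: mult.assoc)
  next
    fix c y assume "c \<in> {c. \<forall>u v. a * u * (c * v) = 0 \<and> a * u * c = 0}"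
    then have "a * (u * y) * (c * v) = 0" "a * (u * y) * c = 0" for u v by blast+
    then show "y * c \<in> {c. \<forall>u v. a * u * (c * v) = 0 \<and> a * u * c = 0}"
      by (simp add: mult.assoc)
  qed (auto simp: subspace_def distrib_right distrib_left scale_mult_left scale_mult_right mult.assoc)
  then have "a * y * z = 0" for z by blast
  with left_annihilator_zero y show False by blast
qed

text \<open>Without an identity, \<open>a\<close> is not an evident member of the span; the
  annihilator lemmas provide some nonzero \<open>x * a * y\<close> in it instead.\<close>

lemma span_two_sided_eq_UNIV:
  assumes "a \<noteq> 0"
  shows "span {x * a * y | x y. True} = UNIV"
proof -
  define I where "I = span {x * a * y | x y. True}"
  obtain y where "a * y \<noteq> 0" using left_annihilator_zero assms by blast
  then obtain x where "x * (a * y) \<noteq> 0" using right_annihilator_zero by blast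
  then have ne: "x * a * y \<noteq> 0" by (simp add: mult.assoc)
  have "I = UNIV"
  proof (rule ideal_eq_UNIV[OF ne])
    show "subspace I" by (simp add: I_def)
    show "x * a * y \<in> I" unfolding I_def by (auto intro: span_base)
  next
    fix z u assume "z \<in> I"
    then show "u * z \<in> I" unfolding I_def
    proof (induction z rule: span_induct_alt)
      case base then show ?case by (simp add: span_zero)
    next
      case (step c x1 w)
      then obtain p q where "x1 = p * a * q" by blast
      then have "u * x1 = (u * p) * a * q" by (simp add: mult.assoc)
      then have "u * x1 \<in> span {x * a * y | x y. True}" by (blast intro: span_base)
      with step show ?case by (simp add: distrib_left scale_mult_right span_add span_scale)
    qed
  next
    fix z u assume "z \<in> I"
    then show "z * u \<in> I" unfolding I_def
    proof (induction z rule: span_induct_alt)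
      case base then show ?case by (simp add: span_zero)
    next
      case (step c x1 w)
      then obtain p q where "x1 = p * a * q" by blast
      then have "x1 * u = p * a * (q * u)" by (simp add: mult.assoc)
      then have "x1 * u \<in> span {x * a * y | x y. True}" by (blast intro: span_base)
      with step show ?case by (simp add: distrib_right scale_mult_left span_add span_scale)
    qed
  qed
  then show ?thesis by (simp add: I_def)
qed

text \<open>An element of A a A involves only finitely many multipliers, and the subalgebra is
  enlarged once for each summand.\<close>

lemma in_local_two_sided_span:
  assumes "a \<noteq> 0" "fin_dim B\<^sub>0"
  obtains B where "subalgebra B" "fin_dim B" "B\<^sub>0 \<subseteq> B" "z \<in> span {x * a * y | x y. x \<in> B \<and> y \<in> B}"
proof -
  have "z \<in> span {x * a * y | x y. True}" using span_two_sided_eq_UNIV[OF assms(1)] by simp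
  then have "\<exists>B. subalgebra B \<and> fin_dim B \<and> B\<^sub>0 \<subseteq> B \<and> z \<in> span {x * a * y | x y. x \<in> B \<and> y \<in> B}"
  proof (induction z rule: span_induct_alt)
    case base
    show ?case using fin_dim_subalgebras_directed[OF assms(2,2)] span_zero by metis
  next
    case (step c z w)
    then obtain x y where z: "z = x * a * y" by blast
    obtain B where B: "subalgebra B" "fin_dim B" "B\<^sub>0 \<subseteq> B" "w \<in> span {x * a * y | x y. x \<in> B \<and> y \<in> B}"
      using step by blast
    obtain C where C: "fin_dim C" "{x, y} \<subseteq> C"
      using fin_dim_subalgebra_containing[of "{x, y}"] by blast
    obtain D where D: "subalgebra D" "fin_dim D" "B \<subseteq> D" "C \<subseteq> D"
      using fin_dim_subalgebras_directed[OF B(2) C(1)] by blast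
    have "span {x * a * y | x y. x \<in> B \<and> y \<in> B} \<subseteq> span {x * a * y | x y. x \<in> D \<and> y \<in> D}"
      by (rule span_mono) (use D(3) in blast)
    then have "w \<in> span {x * a * y | x y. x \<in> D \<and> y \<in> D}"
      using B(4) by (rule subsetD)
    moreover have "z \<in> span {x * a * y | x y. x \<in> D \<and> y \<in> D}"
      using z C(2) D(4) by (auto intro!: span_base)
    ultimately show ?case using B(3) D by (blast intro: span_add span_scale)
  qed
  with that show thesis by blast
qed

section \<open>Nil right ideals and the existence of idempotents\<close>

lemma fin_dim_singleton: "fin_dim (span {x})"
  unfolding fin_dim_def by blast

text \<open>Inside a finite dimensional \<open>B\<close> the right ideal \<open>R = a B\<close> is
  nil, hence nilpotent. Nilpotence of elements spreads to \<open>B R\<close>, which contains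
  \<open>z\<close>, because squaring moves an element of \<open>B (dpow R j)\<close> into
  \<open>B (dpow R (Suc j))\<close>.\<close>

lemma right_ideal_nil_imp_nil:
  assumes "a \<noteq> 0" and nil: "\<And>x. nil (a * x)"
  shows "nil z"
proof -
  obtain B where B: "subalgebra B" "fin_dim B" "span {a} \<subseteq> B"
    "z \<in> span {x * a * y | x y. x \<in> B \<and> y \<in> B}"
    using in_local_two_sided_span[OF assms(1) fin_dim_singleton[of a]] by blast
  have a: "a \<in> B" using B(3) span_base[of a "{a}"] by blast
  define R where "R = (\<lambda>b. a * b) ` B"
  have R: "subalgebra R" "R \<subseteq> B" unfolding subalgebra_def R_def
    using subspace_mult_left subalgebraD[OF B(1)] a by (auto simp: mult.assoc)
  have "fin_dim R" using fin_dim_mono[OF B(2)] R subalgebraD by blast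
  moreover have "nil r" if "r \<in> R" for r using that nil R_def by auto
  ultimately obtain k where k: "dpow R k = {0}" using nil_subalgebra_nilpotent R(1) by blast
  \<comment> \<open>The powers of \<open>R\<close> remain right ideals of \<open>B\<close>.\<close>
  have rB: "r * b \<in> dpow R j" if "r \<in> dpow R j" "b \<in> B" for r b j
    using that(1)
  proof (induction j arbitrary: r)
    case 0 then show ?case using that(2) subalgebraD[OF B(1)] by (auto simp: R_def mult.assoc)
  next
    case (Suc j)
    have "dpow R (Suc j) \<subseteq> {r. r * b \<in> dpow R (Suc j)}"
      unfolding dpow.simps(2)
    proof (rule set_prod_minimal)
      show "subspace {r. r * b \<in> set_prod (dpow R j) (dpow R j)}"
        using subspace_set_prod[of "dpow R j" "dpow R j"]
        by (simp add: subspace_def distrib_right scale_mult_left)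
    qed (use Suc.IH set_prodI in \<open>auto simp: mult.assoc\<close>)
    with Suc.prems show ?case by blast
  qed
  \<comment> \<open>Regroup (b r)(b' r') as b ((r b') r') and absorb b' into the power of
    \<open>R\<close>.\<close>
  have sq: "w * w \<in> set_prod B (dpow R (Suc j))" if "w \<in> set_prod B (dpow R j)" for w j
  proof -
    let ?G = "{b * r | b r. b \<in> B \<and> r \<in> dpow R j}"
    have "w * w \<in> set_prod ?G ?G" using that span_mult[of w ?G w ?G] by (simp add: set_prod_def)
    moreover have "set_prod ?G ?G \<subseteq> set_prod B (dpow R (Suc j))"
    proof (rule set_prod_minimal[OF subspace_set_prod])
      fix u v assume "u \<in> ?G" "v \<in> ?G"
      then obtain b r b' r' where u: "u = b * r" "b \<in> B" "r \<in> dpow R j"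
        and v: "v = b' * r'" "b' \<in> B" "r' \<in> dpow R j" by blast
      have "(r * b') * r' \<in> dpow R (Suc j)" using rB u v set_prodI by simp
      then show "u * v \<in> set_prod B (dpow R (Suc j))"
        using set_prodI[OF u(2)] u(1) v(1) by (simp add: mult.assoc)
    qed
    ultimately show ?thesis by blast
  qed
  \<comment> \<open>Induction downwards from \<open>k\<close>, where the product is zero: an element
    is nil once its square is.\<close>
  have "\<forall>w \<in> set_prod B (dpow R (k - i)). nil w" if "i \<le> k" for i
    using that
  proof (induction i)
    case 0
    have "set_prod B (dpow R k) \<subseteq> {0}" using k by (intro set_prod_minimal) auto
    moreover have "nil 0" unfolding nil_def by (rule exI[of _ 0]) simp
    ultimately show ?case by auto
  next
    case (Suc i)
    then have eq: "k - i = Suc (k - Suc i)" by simp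
    show ?case
    proof
      fix w assume "w \<in> set_prod B (dpow R (k - Suc i))"
      then have "nil (w * w)" using sq Suc eq by simp
      then show "nil w" by (rule nil_square)
    qed
  qed
  from this[of k] have "\<forall>w \<in> set_prod B R. nil w" by simp
  moreover have "span {x * a * y | x y. x \<in> B \<and> y \<in> B} \<subseteq> set_prod B R"
    by (rule span_minimal) (auto simp: subspace_set_prod mult.assoc R_def intro!: set_prodI)
  ultimately show ?thesis using B(4) by blast
qed

lemma span_sandwich:
  assumes "u \<in> span G"
  shows "x * u * y \<in> span ((\<lambda>g. x * g * y) ` G)"
  using assms
proof (induction u rule: span_induct_alt)
  case base then show ?case by (simp add: span_zero)
next
  case (step c z w)
  then show ?case
    by (simp add: distrib_left distrib_right scale_mult_left scale_mult_right span_add span_scale span_base)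
qed

text \<open>Otherwise every element is nil, and a finite dimensional \<open>B\<close> with
  \<open>a\<close> in \<open>B a B\<close> is nilpotent. Substituting the expression for
  \<open>a\<close> into itself puts \<open>a\<close> between ever higher powers of \<open>B\<close>,
  so \<open>a = 0\<close>.\<close>

lemma exists_non_nil_right_multiple:
  assumes "a \<noteq> 0"
  obtains x where "\<not> nil (a * x)"
proof (rule ccontr)
  assume "\<not> thesis"
  then have nil: "nil z" for z using right_ideal_nil_imp_nil[OF assms] that by blast
  obtain B where B: "subalgebra B" "fin_dim B"
    "a \<in> span {x * a * y | x y. x \<in> B \<and> y \<in> B}"
    using in_local_two_sided_span[OF assms fin_dim_singleton[of a]] by blast
  obtain k where k: "dpow B k = {0}" using nil_subalgebra_nilpotent[OF B(1,2)] nil by blast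
  define D where "D j = {x * a * y | x y. x \<in> dpow B j \<and> y \<in> dpow B j}" for j
  have "a \<in> span (D j)" for j
  proof (induction j)
    case 0 then show ?case using B by (simp add: D_def)
  next
    case (Suc j)
    have "D j \<subseteq> span (D (Suc j))"
    proof
      fix z assume "z \<in> D j"
      then obtain x y where z: "z = x * a * y" "x \<in> dpow B j" "y \<in> dpow B j" by (auto simp: D_def)
      have "(\<lambda>g. x * g * y) ` D j \<subseteq> D (Suc j)"
      proof
        fix w assume "w \<in> (\<lambda>g. x * g * y) ` D j"
        then obtain x' y' where w: "w = x * (x' * a * y') * y" "x' \<in> dpow B j" "y' \<in> dpow B j"
          by (auto simp: D_def)
        then have "w = (x * x') * a * (y' * y)" by (simp add: mult.assoc)
        moreover have "x * x' \<in> dpow B (Suc j)" "y' * y \<in> dpow B (Suc j)"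
          using z w set_prodI by auto
        ultimately show "w \<in> D (Suc j)" unfolding D_def by blast
      qed
      then show "z \<in> span (D (Suc j))"
        using span_sandwich[OF Suc.IH, of x y] span_mono z(1) by blast
    qed
    then show ?case using Suc.IH span_minimal[OF _ subspace_span] by blast
  qed
  from this[of k] have "a \<in> span (D k)" .
  moreover have "span (D k) \<subseteq> {0}" by (rule span_minimal) (auto simp: D_def k)
  ultimately show False using assms by blast
qed

lemma idempotent_of_non_nil':
  assumes "\<not> nil x"
  obtains d where "x * d = d * x" "(x * d) * (x * d) = x * d" "x * d \<noteq> 0"
proof -
  obtain B where B: "subalgebra B" "fin_dim B" "{x} \<subseteq> B"
    using fin_dim_subalgebra_containing[of "{x}"] by auto
  then have "x \<in> B" by simp
  then show thesis using idempotent_of_non_nil[OF B(1,2) _ assms] that by blast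
qed

lemma exists_idempotent:
  obtains h :: 'a where "h * h = h" "h \<noteq> 0"
proof -
  obtain x y :: 'a where "x * y \<noteq> 0" using nonzero_product by blast
  then obtain z where "\<not> nil (x * y * z)" using exists_non_nil_right_multiple by blast
  then show thesis using idempotent_of_non_nil' that by blast
qed

section \<open>Corners without proper idempotents\<close>

text \<open>For idempotent \<open>h\<close> this is membership in the corner h A h, whose identity
  is \<open>h\<close>.\<close>

definition in_corner :: "'a \<Rightarrow> 'a \<Rightarrow> bool" where
  "in_corner h x \<longleftrightarrow> h * x = x \<and> x * h = x"

definition trivial_corner_idempotents :: "'a \<Rightarrow> bool" where
  "trivial_corner_idempotents h \<longleftrightarrow> (\<forall>g. in_corner h g \<longrightarrow> g * g = g \<longrightarrow> g = 0 \<or> g = h)"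

text \<open>A nonzero \<open>a\<close> has an idempotent right multiple; moved into the corner, it
  must equal \<open>h\<close>. So \<open>a\<close> has a right inverse there, hence so has each of
  its powers, and none of them vanishes.\<close>

lemma corner_nil_eq_zero:
  assumes h: "h * h = h" "h \<noteq> 0" "trivial_corner_idempotents h"
    and a: "in_corner h a" "nil a"
  shows "a = 0"
proof (rule ccontr)
  assume "a \<noteq> 0"
  then obtain x where "\<not> nil (a * x)" by (rule exists_non_nil_right_multiple)
  then obtain d where d: "(a * x) * d = d * (a * x)" "(a * x * d) * (a * x * d) = a * x * d"
    "a * x * d \<noteq> 0" using idempotent_of_non_nil' by blast
  \<comment> \<open>As \<open>h * a = a\<close>, the factor \<open>h\<close> can be inserted; it
    then makes \<open>a * x * d * h\<close> idempotent.\<close>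
  have "(a * x * d) * h * (a * x * d) = a * x * d" using d(2) a(1)
    by (metis in_corner_def mult.assoc)
  then have idem: "(a * x * d * h) * (a * x * d * h) = a * x * d * h"
    by (simp flip: mult.assoc)
  have c: "in_corner h (a * x * d * h)" using a(1) h(1) by (simp add: in_corner_def mult.assoc) (simp flip: mult.assoc)
  have "a * x * d * h \<noteq> 0" using \<open>a * x * d * h * (a * x * d) = a * x * d\<close> d(3) by auto
  then have inv: "a * (x * d * h) = h" using h(3) c idem
    by (auto simp: trivial_corner_idempotents_def mult.assoc)
  have "\<exists>z. rpow a k * z = h" for k
  proof (induction k)
    case 0 then show ?case using inv by auto
  next
    case (Suc k)
    then obtain z where z: "rpow a k * z = h" by blast
    have "rpow a (Suc k) * (z * (x * d * h)) = a * (rpow a k * z) * (x * d * h)"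
      by (simp add: mult.assoc)
    also have "\<dots> = h" using z a(1) inv by (simp add: in_corner_def)
    finally show ?case by blast
  qed
  with a(2) h(2) show False by (metis mult_zero_left nil_def)
qed

text \<open>That \<open>a\<close> and \<open>d\<close> commute puts \<open>a * d\<close> in the
  corner from both sides, and turns \<open>a * d = h\<close> into a left inverse.\<close>

lemma corner_invertible:
  assumes h: "h * h = h" "h \<noteq> 0" "trivial_corner_idempotents h"
    and a: "in_corner h a" "a \<noteq> 0"
  obtains y where "y * a = h"
proof -
  have "\<not> nil a" using corner_nil_eq_zero assms by blast
  then obtain d where d: "a * d = d * a" "(a * d) * (a * d) = a * d" "a * d \<noteq> 0"
    using idempotent_of_non_nil' by blast
  have "h * (a * d) = a * d" "(d * a) * h = d * a"
    using a(1) by (simp_all add: in_corner_def mult.assoc) (simp flip: mult.assoc)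
  then have "in_corner h (a * d)" using d(1) by (simp add: in_corner_def)
  with h(3) d have "a * d = h" by (auto simp: trivial_corner_idempotents_def)
  with d(1) that show thesis by auto
qed

text \<open>A minimal polynomial argument: if r = (X - c) s has least degree with r(x) h = 0, then
  s(x) h is nonzero, hence invertible in the corner, and cancelling it leaves x = c h.\<close>

lemma corner_scalar:
  assumes closed: "\<And>p :: 'f poly. degree p > 0 \<Longrightarrow> \<exists>c. poly p c = 0"
    and h: "h * h = h" "h \<noteq> 0" "trivial_corner_idempotents h" and x: "in_corner h x"
  shows "\<exists>c. x = c *s h"
proof -
  obtain B where B: "subalgebra B" "fin_dim B" "{x, h} \<subseteq> B"
    using fin_dim_subalgebra_containing[of "{x, h}"] by auto
  then have xB: "x \<in> B" "h \<in> B" by auto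
  obtain k where "\<And>j. j \<ge> k \<Longrightarrow> \<exists>q. pev x h (monom 1 k) = pev x h (monom 1 j * q)"
    using pev_stabilizes[OF B(1,2) xB] by blast
  then obtain q where q: "pev x h (monom 1 k) = pev x h (monom 1 (Suc k) * q)" by force
  define p where "p = monom 1 k - monom 1 (Suc k) * q"
  \<comment> \<open>The subtracted multiple of X^(k+1) cannot affect the coefficient of X^k.\<close>
  have "coeff p k = 1" by (simp add: p_def coeff_monom_mult)
  then have "p \<noteq> 0" by auto
  moreover have "pev x h p = 0" by (simp add: p_def pev_diff q)
  ultimately obtain r where r: "r \<noteq> 0" "pev x h r = 0"
    and min: "\<And>s. s \<noteq> 0 \<Longrightarrow> pev x h s = 0 \<Longrightarrow> degree r \<le> degree s"
    using ex_has_least_nat[of "\<lambda>r. r \<noteq> 0 \<and> pev x h r = 0" p degree] by blast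
  have "degree r > 0"
  proof (rule ccontr)
    assume "\<not> degree r > 0"
    then obtain c where "r = [:c:]" by (auto elim: degree_eq_zeroE)
    with r h(2) show False by simp
  qed
  then obtain c where "poly r c = 0" using closed by blast
  then obtain s where s: "r = [:- c, 1:] * s" by (metis dvdE poly_eq_0_iff_dvd)
  then have "s \<noteq> 0" using r(1) by auto
  then have "degree s < degree r" using s by (simp add: degree_mult_eq del: mult_pCons_left)
  then have ne: "pev x h s \<noteq> 0" using min[OF \<open>s \<noteq> 0\<close>] by auto
  have corner: "in_corner h (pev x h s)"
    unfolding in_corner_def
  proof
    show "h * pev x h s = pev x h s"
      by (induction s)
        (use h(1) x in \<open>simp_all add: in_corner_def distrib_left scale_mult_right flip: mult.assoc\<close>)
    show "pev x h s * h = pev x h s" by (simp add: pev_times h(1))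
  qed
  obtain y where y: "y * pev x h s = h" using corner_invertible[OF h corner ne] by blast
  \<comment> \<open>With the linear factor innermost, \<open>pev_times\<close> rewrites the value as
    the product of s(x) h and x h - c h.\<close>
  have "pev x h (s * [:- c, 1:]) = 0" using r(2) s by (simp add: mult.commute)
  then have "pev x (pev x h [:- c, 1:]) s = 0" by (simp only: pev_mult)
  moreover have "h * pev x h [:- c, 1:] = pev x h [:- c, 1:]"
    using h(1) x by (simp add: in_corner_def right_diff_distrib scale_mult_right flip: mult.assoc)
  ultimately have "pev x h s * pev x h [:- c, 1:] = 0" by (simp only: pev_times)
  then have "h * pev x h [:- c, 1:] = 0" using y by (metis mult.assoc mult_zero_right)
  then have "pev x h [:- c, 1:] = 0" using \<open>h * pev x h [:- c, 1:] = pev x h [:- c, 1:]\<close> by simp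
  then have "x = c *s h" using x h(1) by (simp add: in_corner_def)
  then show ?thesis by blast
qed

end

section \<open>Systems of matrix units\<close>

context assoc_algebra
begin

text \<open>The products \<open>v i * w j\<close> are then \<open>N \<times> N\<close> matrix units.\<close>

definition dual_system :: "'a \<Rightarrow> nat \<Rightarrow> (nat \<Rightarrow> 'a) \<Rightarrow> (nat \<Rightarrow> 'a) \<Rightarrow> bool" where
  "dual_system h N v w \<longleftrightarrow> h \<noteq> 0 \<and> h * h = h \<and>
     (\<forall>i<N. v i * h = v i \<and> h * w i = w i) \<and>
     (\<forall>i<N. \<forall>j<N. w i * v j = (if i = j then h else 0))"

end

context simple_locally_finite_algebra
begin

text \<open>A Gram-Schmidt step for the pairing given by multiplication. The idempotent
  \<open>P\<close> projects onto the part already covered; a vector outside it and a dual functional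
  are both corrected by \<open>P\<close>.\<close>

lemma dual_system_extend_scalar:
  assumes inf: "\<not> fin_dim UNIV"
    and scalar: "\<And>x. in_corner h x \<Longrightarrow> \<exists>c. x = c *s h"
    and D: "dual_system h n v w"
  shows "\<exists>v w. dual_system h (Suc n) v w"
proof -
  have h: "h \<noteq> 0" "h * h = h" and vh: "\<And>i. i < n \<Longrightarrow> v i * h = v i"
    and hw: "\<And>i. i < n \<Longrightarrow> h * w i = w i"
    and wv: "\<And>i j. i < n \<Longrightarrow> j < n \<Longrightarrow> w i * v j = (if i = j then h else 0)"
    using D by (auto simp: dual_system_def)
  define P where "P = (\<Sum>i<n. v i * w i)"
  have wP: "w j * P = w j" if "j < n" for j
  proof -
    have "w j * P = (\<Sum>i<n. if i = j then w j else 0)"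
      unfolding P_def sum_distrib_left
      by (rule sum.cong) (use that wv hw in \<open>auto simp flip: mult.assoc\<close>)
    with that show ?thesis by simp
  qed
  have Pv: "P * v j = v j" if "j < n" for j
  proof -
    have "P * v j = (\<Sum>i<n. if i = j then v j else 0)"
      unfolding P_def sum_distrib_right
      by (rule sum.cong) (use that wv vh in \<open>auto simp: mult.assoc\<close>)
    with that show ?thesis by simp
  qed
  \<comment> \<open>If \<open>P\<close> were a left identity, the finitely many products
    \<open>v i * w j\<close> would span the algebra.\<close>
  have "\<exists>a. P * a \<noteq> a"
  proof (rule ccontr)
    assume "\<not> ?thesis"
    then have P1: "P * a = a" for a by blast
    \<comment> \<open>A left identity also acts as a right identity on h A, since left annihilators
      vanish.\<close>
    have P2: "h * a * P = h * a" for a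
    proof -
      define u where "u = h * a - h * a * P"
      have "u * x = 0" for x using P1 by (simp add: u_def left_diff_distrib mult.assoc)
      then have "u = 0" by (rule left_annihilator_zero)
      then show ?thesis by (simp add: u_def)
    qed
    define G where "G = (\<lambda>(i, j). v i * w j) ` ({..<n} \<times> {..<n})"
    have gen: "x * h * y \<in> span G" for x y
    proof -
      have wxv: "\<exists>c. w i * (x * h * y) * v j = c *s h" if "i < n" "j < n" for i j
      proof (rule scalar)
        have "h * (w i * (x * h * y) * v j) = (h * w i) * (x * h * y) * v j" by (simp add: mult.assoc)
        moreover have "(w i * (x * h * y) * v j) * h = w i * (x * h * y) * (v j * h)" by (simp add: mult.assoc)
        ultimately show "in_corner h (w i * (x * h * y) * v j)"
          using that vh hw by (simp add: in_corner_def)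
      qed
      \<comment> \<open>Placing \<open>P\<close> on both sides isolates the factors
        \<open>w i * (x * h * y) * v j\<close>, which are scalar multiples of
        \<open>h\<close>.\<close>
      have "x * h * y = x * (h * y * P)" using P2[of y] by (simp add: mult.assoc)
      then have "x * h * y = P * (x * h * y) * P" by (simp add: P1 mult.assoc)
      also have "\<dots> = (\<Sum>j<n. \<Sum>i<n. v i * w i * (x * h * y) * (v j * w j))"
        by (simp add: P_def sum_distrib_left sum_distrib_right)
      also have "\<dots> \<in> span G"
      proof (intro span_sum)
        fix j i assume ij: "j \<in> {..<n}" "i \<in> {..<n}"
        then obtain c where c: "w i * (x * h * y) * v j = c *s h" using wxv by auto
        have "v i * w i * (x * h * y) * (v j * w j) = v i * (w i * (x * h * y) * v j) * w j"
          by (simp add: mult.assoc)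
        also have "\<dots> = c *s (v i * w j)"
          using c vh ij by (simp add: scale_mult_left scale_mult_right)
        also have "\<dots> \<in> span G"
          by (rule span_scale[OF span_base]) (use ij in \<open>auto simp: G_def\<close>)
        finally show "v i * w i * (x * h * y) * (v j * w j) \<in> span G" .
      qed
      finally show ?thesis .
    qed
    have "span {x * h * y | x y. True} \<subseteq> span G"
      by (rule span_minimal) (use gen in auto)
    then have "span G = UNIV" using span_two_sided_eq_UNIV[OF h(1)] by blast
    moreover have "finite G" by (simp add: G_def)
    ultimately show False using inf by (auto simp: fin_dim_def)
  qed
  then obtain a where "P * a - a \<noteq> 0" by auto
  then obtain x where x: "(P * a - a) * x * h \<noteq> 0" using nonzero_sandwich[of _ h] h(1) by blast
  \<comment> \<open>The component complementary to \<open>P\<close>, hence orthogonal to every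
    \<open>w i\<close>.\<close>
  define b where "b = a * x * h - P * (a * x * h)"
  have b: "b \<noteq> 0" using x by (auto simp: b_def left_diff_distrib mult.assoc)
  have bh: "b * h = b" by (simp add: b_def left_diff_distrib mult.assoc h(2))
  have wb: "w i * b = 0" if "i < n" for i
    using wP[OF that] by (simp add: b_def right_diff_distrib flip: mult.assoc)
  obtain y where y: "h * y * b \<noteq> 0" using nonzero_sandwich[OF h(1) b] by blast
  have "in_corner h (h * y * b)"
    using h(2) bh by (simp add: in_corner_def mult.assoc) (simp flip: mult.assoc)
  then obtain c where c: "h * y * b = c *s h" using scalar by blast
  with y have "c \<noteq> 0" by auto
  define z where "z = inverse c *s (h * y)"
  have zb: "z * b = h" using c \<open>c \<noteq> 0\<close> by (simp add: z_def scale_mult_left)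
  have hz: "h * z = z" using h(2) by (simp add: z_def scale_mult_right flip: mult.assoc)
  \<comment> \<open>Removing \<open>z * P\<close> makes \<open>u\<close> kill every
    \<open>v j\<close> and keeps the pairing with \<open>b\<close>, because
    \<open>P * b = 0\<close>.\<close>
  define u where "u = z - z * P"
  have ub: "u * b = h"
  proof -
    have "P * b = 0" using wb by (simp add: P_def sum_distrib_right mult.assoc)
    then show ?thesis by (simp add: u_def left_diff_distrib mult.assoc zb)
  qed
  have hu: "h * u = u" using hz by (simp add: u_def right_diff_distrib flip: mult.assoc)
  have uv: "u * v j = 0" if "j < n" for j
    using Pv[OF that] by (simp add: u_def left_diff_distrib mult.assoc)
  have "dual_system h (Suc n) (v(n := b)) (w(n := u))"
    unfolding dual_system_def using h vh hw wv bh hu ub uv wb by (auto simp: less_Suc_eq)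
  then show ?thesis by blast
qed

text \<open>With \<open>f = h - g\<close>, take \<open>a\<close> in g A f and \<open>b\<close> in f
  A g whose product is not nilpotent. An idempotent \<open>k\<close> below \<open>g\<close> factors
  through \<open>f\<close>; it replaces \<open>h\<close>, and its copy below \<open>f\<close> gives
  the additional index.\<close>

lemma dual_system_extend_split:
  assumes D: "dual_system h n v w" and n: "n > 0"
    and g: "in_corner h g" "g * g = g" "g \<noteq> 0" "g \<noteq> h"
  shows "\<exists>h v w. dual_system h (Suc n) v w"
proof -
  have h: "h \<noteq> 0" "h * h = h" and vh: "\<And>i. i < n \<Longrightarrow> v i * h = v i"
    and hw: "\<And>i. i < n \<Longrightarrow> h * w i = w i"
    and wv: "\<And>i j. i < n \<Longrightarrow> j < n \<Longrightarrow> w i * v j = (if i = j then h else 0)"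
    using D by (auto simp: dual_system_def)
  have hg: "h * g = g" "g * h = g" using g(1) by (auto simp: in_corner_def)
  define f where "f = h - g"
  have f: "f \<noteq> 0" "g * f = 0" "f * g = 0" "h * f = f" "f * h = f"
    using g h(2) hg by (auto simp: f_def right_diff_distrib left_diff_distrib)
  have ff: "f * f = f" using f(3,5) by (simp add: f_def right_diff_distrib)
  obtain s where "g * s * f \<noteq> 0" using nonzero_sandwich[OF g(3) f(1)] by blast
  then obtain t where t: "\<not> nil (g * s * f * t)" using exists_non_nil_right_multiple by blast
  define a where "a = g * s * f"
  define b where "b = f * t * g"
  \<comment> \<open>The final factor \<open>g\<close> of \<open>b\<close> can be absorbed: (a
    t)^(k+2) = (a b)^(k+1) (a t).\<close>
  have "\<not> nil (a * b)"
  proof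
    assume "nil (a * b)"
    then obtain k where k: "rpow (a * b) k = 0" by (auto simp: nil_def)
    have ab: "a * b = a * t * g" using ff by (simp add: a_def b_def mult.assoc) (simp flip: mult.assoc)
    have ga: "g * (a * u) = a * u" for u using g(2) by (simp add: a_def flip: mult.assoc)
    have "rpow (a * t) (Suc k) = rpow (a * b) k * (a * t)"
    proof (induction k)
      case 0 then show ?case using ab ga by (simp add: mult.assoc)
    next
      case (Suc k)
      have "a * b * (rpow (a * b) k * (a * t)) = a * t * (g * (rpow (a * b) k * (a * t)))"
        using ab by (simp add: mult.assoc)
      also have "g * (rpow (a * b) k * (a * t)) = rpow (a * b) k * (a * t)"
        by (cases k) (simp_all add: mult.assoc ga)
      finally show ?case using Suc by (simp add: mult.assoc)
    qed
    with k have "rpow (a * t) (Suc k) = 0" by simp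
    with t show False unfolding nil_def a_def by blast
  qed
  then obtain d where d: "(a * b) * d = d * (a * b)" "(a * b * d) * (a * b * d) = a * b * d"
    "a * b * d \<noteq> 0" using idempotent_of_non_nil' by blast
  define k where "k = a * b * d"
  have k: "k \<noteq> 0" "k * k = k" using d by (auto simp: k_def)
  have ga: "g * a = a" and bg: "b * g = b" and fb: "f * b = b"
    using g(2) f by (simp_all add: a_def b_def mult.assoc) (simp_all flip: mult.assoc add: f_def left_diff_distrib right_diff_distrib h(2) hg g(2))
  have gk: "g * k = k" using ga by (simp add: k_def flip: mult.assoc)
  have "k * g = d * (a * b) * g" by (simp only: k_def d(1))
  also have "\<dots> = k" using bg by (simp add: k_def d(1)) (simp add: mult.assoc)
  finally have kg: "k * g = k" .
  have hk: "h * k = k" "k * h = k" using gk kg hg by (metis mult.assoc)+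
  have kb: "k * b = 0"
  proof -
    have "k * b = k * (g * f) * b" using kg fb by (simp flip: mult.assoc) (simp add: mult.assoc fb)
    then show ?thesis using f(2) by simp
  qed
  have af: "a * k = 0"
  proof -
    have "a * f = a" using ff by (simp add: a_def mult.assoc)
    then have "a * k = a * (f * g) * k" using gk by (simp add: mult.assoc) (simp flip: mult.assoc)
    then show ?thesis using f(3) by simp
  qed
  \<comment> \<open>Old vectors are cut down by \<open>k\<close>. The new pair passes through index
    \<open>0\<close> and uses k a (b d) k = k; it is orthogonal to the old ones because
    \<open>k * b = 0\<close> and \<open>a * k = 0\<close>.\<close>
  define v' where "v' = (\<lambda>i. v i * k)(n := v 0 * (b * d * k))"
  define w' where "w' = (\<lambda>i. k * w i)(n := k * a * w 0)"
  have m: "(k * w i) * (v j * x) = (if i = j then k * x else 0)" if "i < n" "j < n" for i j x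
  proof -
    have "(k * w i) * (v j * x) = k * (w i * v j) * x" by (simp add: mult.assoc)
    then show ?thesis using wv that hk by simp
  qed
  have m0: "(k * a * w 0) * (v j * x) = (if j = 0 then k * a * x else 0)" if "j < n" for j x
  proof -
    have ah: "a * h = a" using f(5) by (simp add: a_def mult.assoc)
    have "(k * a * w 0) * (v j * x) = k * a * (w 0 * v j) * x" by (simp add: mult.assoc)
    moreover have "k * a * h * x = k * a * x" using ah by (simp add: mult.assoc)
    ultimately show ?thesis using wv that n by simp
  qed
  have kx: "k * (b * x) = 0" for x using kb by (simp flip: mult.assoc)
  have kk: "k * (k * x) = k * x" for x using k(2) by (simp flip: mult.assoc)
  have kab: "k * a * (b * d * k) = k"
  proof -
    have "k * a * (b * d * k) = k * (a * b * d) * k" by (simp add: mult.assoc)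
    then show ?thesis using k(2) by (simp add: k_def[symmetric])
  qed
  have "dual_system k (Suc n) v' w'"
    unfolding dual_system_def
  proof (intro conjI allI impI)
    fix i j assume ij: "i < Suc n" "j < Suc n"
    show "w' i * v' j = (if i = j then k else 0)"
      using ij n m m0 k(2) kab kx af by (auto simp: less_Suc_eq v'_def w'_def mult.assoc)
  qed (use k in \<open>auto simp: v'_def w'_def mult.assoc kk\<close>)
  then show ?thesis by blast
qed

text \<open>The scalar step keeps \<open>h\<close> fixed and can start from size 0. The splitting
  step shrinks \<open>h\<close> and needs index \<open>0\<close>, so that induction starts from size
  1.\<close>

lemma exists_dual_system:
  assumes inf: "\<not> fin_dim UNIV"
    and closed: "\<And>p :: 'f poly. degree p > 0 \<Longrightarrow> \<exists>c. poly p c = 0"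
  shows "\<exists>h v w. dual_system h N v w"
proof (cases "\<exists>h. h \<noteq> 0 \<and> h * h = h \<and> trivial_corner_idempotents h")
  case True
  then obtain h where h: "h \<noteq> 0" "h * h = h" "trivial_corner_idempotents h" by blast
  have "\<exists>v w. dual_system h N v w"
  proof (induction N)
    case 0 show ?case using h by (simp add: dual_system_def)
  next
    case (Suc n)
    then show ?case using dual_system_extend_scalar[OF inf] corner_scalar[OF closed h(2,1,3)] by blast
  qed
  then show ?thesis by blast
next
  case False
  have "\<exists>h v w. dual_system h (Suc n) v w" for n
  proof (induction n)
    case 0
    obtain h :: 'a where "h * h = h" "h \<noteq> 0" by (rule exists_idempotent)
    then have "dual_system h (Suc 0) (\<lambda>_. h) (\<lambda>_. h)" by (simp add: dual_system_def)
    then show ?case by blast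
  next
    case (Suc n)
    then obtain h v w where D: "dual_system h (Suc n) v w" by blast
    then have "\<not> trivial_corner_idempotents h" using False by (auto simp: dual_system_def)
    then show ?case using dual_system_extend_split[OF D] unfolding trivial_corner_idempotents_def by blast
  qed
  then show ?thesis by (cases N) (use exists_idempotent in \<open>auto simp: dual_system_def, metis\<close>)
qed

end

section \<open>Composition series\<close>

text \<open>
  The pivot positions of a subspace of the column space; their number is its dimension.
\<close>

definition lead_pos :: "nat \<Rightarrow> 'f::field vec set \<Rightarrow> nat set" where
  "lead_pos n W = {k. k < n \<and> (\<exists>w\<in>W. w $ k \<noteq> 0 \<and> (\<forall>j<k. w $ j = 0))}"

lemma card_lead_pos_le: "card (lead_pos n W) \<le> n"
  using card_mono[of "{..<n}" "lead_pos n W"] by (auto simp: lead_pos_def)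

text \<open>Gaussian elimination: if the pivots agree, every vector of \<open>W\<close> can be
  reduced to zero by vectors of \<open>U\<close>.\<close>

lemma card_lead_pos_strict_mono:
  fixes \<rho> :: "'a \<Rightarrow> 'f::field mat"
  assumes U: "rep_submodule C n \<rho> U" and W: "rep_submodule C n \<rho> W" and "U \<subset> W"
  shows "card (lead_pos n U) < card (lead_pos n W)"
proof (rule psubset_card_mono)
  show "finite (lead_pos n W)" by (rule finite_subset[of _ "{..<n}"]) (auto simp: lead_pos_def)
  show "lead_pos n U \<subset> lead_pos n W"
  proof
    show "lead_pos n U \<subseteq> lead_pos n W" using \<open>U \<subset> W\<close> by (auto simp: lead_pos_def)
    show "lead_pos n U \<noteq> lead_pos n W"
    proof
      assume eq: "lead_pos n U = lead_pos n W"
      \<comment> \<open>The induction is on the length \<open>i\<close> of the tail that may be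
        nonzero.\<close>
      have "w \<in> U" if "i \<le> n" "w \<in> W" "\<forall>j<n - i. w $ j = 0"
        for i and w :: "'f vec"
        using that
      proof (induction i arbitrary: w)
        case 0
        then have "w = 0\<^sub>v n" using W by (intro eq_vecI) (auto simp: rep_submodule_def)
        then show ?case using U by (simp add: rep_submodule_def)
      next
        case (Suc i)
        define k where "k = n - Suc i"
        have k: "k < n" "n - i = Suc k" using Suc.prems(1) by (auto simp: k_def)
        show ?case
        proof (cases "w $ k = 0")
          case True
          then show ?thesis using Suc k by (auto simp: less_Suc_eq simp flip: k_def)
        next
          case False
          with Suc.prems k have "k \<in> lead_pos n W" by (auto simp: lead_pos_def k_def)
          then have "k \<in> lead_pos n U" by (simp add: eq)
          then obtain u :: "'f vec" where u: "u \<in> U" "u $ k \<noteq> 0" "\<forall>j<k. u $ j = 0"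
            by (auto simp: lead_pos_def)
          define c where "c = w $ k / u $ k"
          have dims: "u \<in> carrier_vec n" "w \<in> carrier_vec n"
            using u(1) Suc.prems(2) U W by (auto simp: rep_submodule_def)
          define z where "z = w + (- c) \<cdot>\<^sub>v u"
          have "z \<in> W" using u(1) Suc.prems(2) \<open>U \<subset> W\<close> W unfolding z_def rep_submodule_def by blast
          moreover have "\<forall>j<n - i. z $ j = 0"
            using k u dims Suc.prems(3) by (auto simp: less_Suc_eq z_def c_def simp flip: k_def)
          ultimately have "z \<in> U" using Suc.IH Suc.prems(1) by simp
          moreover have "w = z + c \<cdot>\<^sub>v u" using dims by (intro eq_vecI) (auto simp: z_def)
          ultimately show ?thesis using u(1) U unfolding rep_submodule_def by blast
        qed
      qed
      from this[of n] have "W \<subseteq> U" by auto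
      with \<open>U \<subset> W\<close> show False by blast
    qed
  qed
qed

text \<open>Below \<open>W\<close>, a proper submodule with the most pivots is maximal, since
  anything strictly between would have more. Its chain is extended by \<open>W\<close>.\<close>

lemma exists_maximal_chain:
  fixes \<rho> :: "'a \<Rightarrow> 'f::field mat"
  assumes \<rho>: "\<And>c. c \<in> C \<Longrightarrow> \<rho> c \<in> carrier_mat n n" and "rep_submodule C n \<rho> W"
  shows "\<exists>Ws. Ws \<noteq> [] \<and> hd Ws = {0\<^sub>v n} \<and> last Ws = W \<and> (\<forall>V\<in>set Ws. rep_submodule C n \<rho> V) \<and>
    (\<forall>i. Suc i < length Ws \<longrightarrow> Ws ! i \<subset> Ws ! Suc i \<and>
        \<not> (\<exists>U. rep_submodule C n \<rho> U \<and> Ws ! i \<subset> U \<and> U \<subset> Ws ! Suc i))"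
  using assms(2)
proof (induction "card (lead_pos n W)" arbitrary: W rule: less_induct)
  case less
  have "\<rho> c *\<^sub>v 0\<^sub>v n = 0\<^sub>v n" if "c \<in> C" for c
    using \<rho>[OF that] by (intro eq_vecI) auto
  then have zero: "rep_submodule C n \<rho> {0\<^sub>v n}"
    by (auto simp: rep_submodule_def)
  show ?case
  proof (cases "W = {0\<^sub>v n}")
    case True
    then show ?thesis using less.prems by (intro exI[of _ "[W]"]) auto
  next
    case False
    let ?P = "\<lambda>U. rep_submodule C n \<rho> U \<and> U \<subset> W"
    have "?P {0\<^sub>v n}" using zero False less.prems by (auto simp: rep_submodule_def)
    then have "\<exists>U. ?P U \<and> (\<forall>V. ?P V \<longrightarrow> card (lead_pos n V) \<le> card (lead_pos n U))"
      by (rule ex_has_greatest_nat) (use card_lead_pos_le le_imp_less_Suc in blast)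
    then obtain U where U: "?P U" and max: "\<And>V. ?P V \<Longrightarrow> card (lead_pos n V) \<le> card (lead_pos n U)"
      by blast
    have "card (lead_pos n U) < card (lead_pos n W)"
      using card_lead_pos_strict_mono U less.prems by blast
    from less.hyps[OF this conjunct1[OF U]]
    obtain Ws where Ws: "Ws \<noteq> []" "hd Ws = {0\<^sub>v n}" "last Ws = U" "\<forall>V\<in>set Ws. rep_submodule C n \<rho> V"
      "\<forall>i. Suc i < length Ws \<longrightarrow> Ws ! i \<subset> Ws ! Suc i \<and>
        \<not> (\<exists>U. rep_submodule C n \<rho> U \<and> Ws ! i \<subset> U \<and> U \<subset> Ws ! Suc i)"
      by (elim exE conjE) (rule that)
    have "(Ws @ [W]) ! i \<subset> (Ws @ [W]) ! Suc i \<and>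
      \<not> (\<exists>V. rep_submodule C n \<rho> V \<and> (Ws @ [W]) ! i \<subset> V \<and> V \<subset> (Ws @ [W]) ! Suc i)"
      if "Suc i < length (Ws @ [W])" for i
    proof (cases "Suc i < length Ws")
      case True
      then show ?thesis using Ws(5) by (simp add: nth_append)
    next
      case False
      with that have "i = length Ws - 1" "Suc i = length Ws" by auto
      then have "(Ws @ [W]) ! i = U" "(Ws @ [W]) ! Suc i = W"
        using Ws(1,3) by (auto simp: nth_append last_conv_nth)
      moreover have "\<not> (rep_submodule C n \<rho> V \<and> U \<subset> V \<and> V \<subset> W)" for V
        using max[of V] card_lead_pos_strict_mono[of C n \<rho> U V] U by (meson leD)
      ultimately show ?thesis using U by auto
    qed
    then show ?thesis using Ws less.prems by (intro exI[of _ "Ws @ [W]"]) auto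
  qed
qed

lemma mat_eq_zeroI:
  fixes M :: "'f::field mat"
  assumes "M \<in> carrier_mat n n" "\<And>v. v \<in> carrier_vec n \<Longrightarrow> M *\<^sub>v v = 0\<^sub>v n"
  shows "M = 0\<^sub>m n n"
proof (intro eq_matI)
  fix i j assume ij: "i < dim_row (0\<^sub>m n n :: 'f mat)" "j < dim_col (0\<^sub>m n n :: 'f mat)"
  then have "(M *\<^sub>v unit_vec n j) $ i = M $$ (i, j)"
    using assms(1) by auto
  then show "M $$ (i, j) = (0\<^sub>m n n) $$ (i, j)" using assms(2)[of "unit_vec n j"] ij by auto
qed (use assms in auto)

text \<open>
  An idempotent that maps every term of a composition series into the previous one is zero.
\<close>

lemma has_nontrivial_factor_of_idempotent:
  fixes \<rho> :: "'a \<Rightarrow> 'f::field mat"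
  assumes \<rho>: "\<And>c. c \<in> C \<Longrightarrow> \<rho> c \<in> carrier_mat n n"
    and e: "e \<in> C" "\<rho> e * \<rho> e = \<rho> e" "\<rho> e \<noteq> 0\<^sub>m n n"
  shows "has_nontrivial_factor C n \<rho>"
proof -
  have "rep_submodule C n \<rho> (carrier_vec n)"
    using mult_mat_vec_carrier[OF \<rho>] by (simp add: rep_submodule_def)
  then obtain Ws where Ws: "composition_series C n \<rho> Ws"
    using exists_maximal_chain[of C \<rho> n "carrier_vec n"] \<rho> unfolding composition_series_def by blast
  show ?thesis
  proof (rule ccontr)
    assume neg: "\<not> ?thesis"
    have "\<forall>w\<in>Ws ! i. \<rho> e *\<^sub>v w = 0\<^sub>v n" if "i < length Ws" for i
      using that
    proof (induction i)
      case 0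
      then have "Ws ! 0 = {0\<^sub>v n}" using Ws by (simp add: composition_series_def hd_conv_nth)
      then show ?case using \<rho>[OF e(1)] by (auto intro!: eq_vecI)
    next
      case (Suc i)
      show ?case
      proof
        fix w assume w: "w \<in> Ws ! Suc i"
        then have "\<rho> e *\<^sub>v w \<in> Ws ! i"
          using neg Ws e(1) Suc.prems unfolding has_nontrivial_factor_def by blast
        then have "\<rho> e *\<^sub>v (\<rho> e *\<^sub>v w) = 0\<^sub>v n" using Suc by simp
        moreover have "rep_submodule C n \<rho> (Ws ! Suc i)"
          using Ws Suc.prems by (simp add: composition_series_def)
        then have "w \<in> carrier_vec n" using w by (auto simp: rep_submodule_def)
        ultimately show "\<rho> e *\<^sub>v w = 0\<^sub>v n"
          using e(2) \<rho>[OF e(1)] assoc_mult_mat_vec[of "\<rho> e" n n "\<rho> e" n w] by simp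
      qed
    qed
    moreover have "Ws ! (length Ws - 1) = carrier_vec n" "length Ws - 1 < length Ws"
      using Ws by (auto simp: composition_series_def last_conv_nth)
    ultimately have "\<rho> e *\<^sub>v w = 0\<^sub>v n" if "w \<in> carrier_vec n" for w using that by metis
    then show False using mat_eq_zeroI[OF \<rho>[OF e(1)]] e(3) by blast
  qed
qed

section \<open>Natural modules\<close>

text \<open>The laws are relative to the carrier because the unions defining the operations of
  \<open>quot_alg\<close> are meant for cosets only.\<close>

locale carrier_algebra =
  fixes Q :: "('f, 'q) alg"
  assumes add_closed: "\<lbrakk>x \<in> alg_carrier Q; y \<in> alg_carrier Q\<rbrakk> \<Longrightarrow> alg_add Q x y \<in> alg_carrier Q"
    and mult_closed: "\<lbrakk>x \<in> alg_carrier Q; y \<in> alg_carrier Q\<rbrakk> \<Longrightarrow> alg_mult Q x y \<in> alg_carrier Q"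
    and scale_closed: "x \<in> alg_carrier Q \<Longrightarrow> alg_scale Q c x \<in> alg_carrier Q"
    and zero_closed: "alg_zero Q \<in> alg_carrier Q"
    and add_assoc: "\<lbrakk>x \<in> alg_carrier Q; y \<in> alg_carrier Q; z \<in> alg_carrier Q\<rbrakk> \<Longrightarrow>
      alg_add Q (alg_add Q x y) z = alg_add Q x (alg_add Q y z)"
    and add_commute: "\<lbrakk>x \<in> alg_carrier Q; y \<in> alg_carrier Q\<rbrakk> \<Longrightarrow> alg_add Q x y = alg_add Q y x"
    and add_zero: "x \<in> alg_carrier Q \<Longrightarrow> alg_add Q x (alg_zero Q) = x"
    and distrib_left: "\<lbrakk>x \<in> alg_carrier Q; y \<in> alg_carrier Q; z \<in> alg_carrier Q\<rbrakk> \<Longrightarrow>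
      alg_mult Q x (alg_add Q y z) = alg_add Q (alg_mult Q x y) (alg_mult Q x z)"
    and distrib_right: "\<lbrakk>x \<in> alg_carrier Q; y \<in> alg_carrier Q; z \<in> alg_carrier Q\<rbrakk> \<Longrightarrow>
      alg_mult Q (alg_add Q x y) z = alg_add Q (alg_mult Q x z) (alg_mult Q y z)"
    and mult_zero_right: "x \<in> alg_carrier Q \<Longrightarrow> alg_mult Q x (alg_zero Q) = alg_zero Q"
    and mult_zero_left: "x \<in> alg_carrier Q \<Longrightarrow> alg_mult Q (alg_zero Q) x = alg_zero Q"
    and scale_add: "\<lbrakk>x \<in> alg_carrier Q; y \<in> alg_carrier Q\<rbrakk> \<Longrightarrow>
      alg_scale Q c (alg_add Q x y) = alg_add Q (alg_scale Q c x) (alg_scale Q c y)"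
    and scale_zero: "alg_scale Q c (alg_zero Q) = alg_zero Q"
begin

section \<open>Sums of components and the projections onto them\<close>

abbreviation total :: "'q list \<Rightarrow> 'q" where
  "total ss \<equiv> foldr (alg_add Q) ss (alg_zero Q)"

lemma total_closed: "set ss \<subseteq> alg_carrier Q \<Longrightarrow> total ss \<in> alg_carrier Q"
  by (induction ss) (auto simp: add_closed zero_closed)

lemma total_hom:
  assumes "\<And>x y. \<lbrakk>x \<in> alg_carrier Q; y \<in> alg_carrier Q\<rbrakk> \<Longrightarrow> h (alg_add Q x y) = alg_add Q (h x) (h y)"
    and "h (alg_zero Q) = alg_zero Q" and "set ss \<subseteq> alg_carrier Q"
  shows "h (total ss) = total (map h ss)"
  using assms(3) by (induction ss) (auto simp: assms(1,2) total_closed)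

lemma total_add:
  assumes "length ss = length ts" "set ss \<subseteq> alg_carrier Q" "set ts \<subseteq> alg_carrier Q"
  shows "total (map2 (alg_add Q) ss ts) = alg_add Q (total ss) (total ts)"
  using assms
proof (induction ss ts rule: list_induct2)
  case Nil then show ?case by (simp add: add_zero zero_closed)
next
  case (Cons x xs y ys)
  have "x \<in> alg_carrier Q" "y \<in> alg_carrier Q" "total xs \<in> alg_carrier Q" "total ys \<in> alg_carrier Q"
    using Cons.prems total_closed by auto
  with Cons show ?case by simp (metis add_assoc add_closed add_commute)
qed

lemma total_single:
  assumes "i < n" "x \<in> alg_carrier Q"
  shows "total ((replicate n (alg_zero Q))[i := x]) = x"
  using assms(1)
proof (induction n arbitrary: i)
  case 0 then show ?case by simp
next
  case (Suc n)
  have zero: "total (replicate m (alg_zero Q)) = alg_zero Q" for m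
    by (induction m) (auto simp: add_zero zero_closed)
  show ?case
  proof (cases i)
    case 0 then show ?thesis using assms(2) zero by (simp add: add_zero)
  next
    case (Suc j)
    with Suc.prems Suc.IH[of j] show ?thesis
      using assms(2) by (simp add: add_commute[OF zero_closed] add_zero)
  qed
qed

context
  fixes Ss i
  assumes D: "simple_decomposition Q Ss" and i: "i < length Ss"
begin

lemma component_ideal: "k < length Ss \<Longrightarrow> alg_ideal Q (Ss ! k)"
  using D by (auto simp: simple_decomposition_def)

lemma component_subset: "k < length Ss \<Longrightarrow> Ss ! k \<subseteq> alg_carrier Q"
  using component_ideal by (auto simp: alg_ideal_def)

lemma components_subset:
  assumes "alg_components Q Ss q ss" shows "set ss \<subseteq> alg_carrier Q"
  using assms component_subset by (fastforce simp: alg_components_def in_set_conv_nth)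

lemma proj_eq:
  assumes "q \<in> alg_carrier Q" "alg_components Q Ss q ss"
  shows "alg_proj Q Ss i q = ss ! i"
proof -
  have "\<exists>!ss. alg_components Q Ss q ss" using D assms(1) by (auto simp: simple_decomposition_def)
  then have "(THE ss. alg_components Q Ss q ss) = ss" using assms(2) by (rule the1_equality)
  then show ?thesis by (simp add: alg_proj_def)
qed

lemma components_exist:
  assumes "q \<in> alg_carrier Q"
  obtains ss where "alg_components Q Ss q ss"
  using D assms by (auto simp: simple_decomposition_def)

lemma proj_in: "q \<in> alg_carrier Q \<Longrightarrow> alg_proj Q Ss i q \<in> Ss ! i"
  by (metis components_exist proj_eq alg_components_def i)

text \<open>An additive map that preserves each component acts componentwise, by uniqueness of
  components. It is applied to multiplication from either side and to scaling.\<close>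

lemma proj_commutes:
  assumes "\<And>x y. \<lbrakk>x \<in> alg_carrier Q; y \<in> alg_carrier Q\<rbrakk> \<Longrightarrow> h (alg_add Q x y) = alg_add Q (h x) (h y)"
    and "h (alg_zero Q) = alg_zero Q"
    and "\<And>k x. k < length Ss \<Longrightarrow> x \<in> Ss ! k \<Longrightarrow> h x \<in> Ss ! k"
    and q: "q \<in> alg_carrier Q" "h q \<in> alg_carrier Q"
  shows "alg_proj Q Ss i (h q) = h (alg_proj Q Ss i q)"
proof -
  obtain ss where ss: "alg_components Q Ss q ss" using components_exist q(1) by blast
  then have "alg_components Q Ss (h q) (map h ss)"
    using total_hom[of h ss, OF assms(1,2) components_subset[OF ss]] assms(3)
    by (simp add: alg_components_def)
  then have "alg_proj Q Ss i (h q) = map h ss ! i" by (rule proj_eq[OF q(2)])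
  also have "\<dots> = h (alg_proj Q Ss i q)"
    using proj_eq[OF q(1) ss] ss i by (simp add: alg_components_def)
  finally show ?thesis .
qed

lemma proj_add:
  assumes "q \<in> alg_carrier Q" "r \<in> alg_carrier Q"
  shows "alg_proj Q Ss i (alg_add Q q r) = alg_add Q (alg_proj Q Ss i q) (alg_proj Q Ss i r)"
proof -
  obtain ss ts where ss: "alg_components Q Ss q ss" and ts: "alg_components Q Ss r ts"
    using components_exist assms by metis
  have "alg_components Q Ss (alg_add Q q r) (map2 (alg_add Q) ss ts)"
    using ss ts total_add[OF _ components_subset[OF ss] components_subset[OF ts]] component_ideal
    by (simp add: alg_components_def alg_ideal_def)
  then have "alg_proj Q Ss i (alg_add Q q r) = map2 (alg_add Q) ss ts ! i"
    by (rule proj_eq[OF add_closed[OF assms]])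
  then show ?thesis
    using proj_eq[OF assms(1) ss] proj_eq[OF assms(2) ts] ss ts i by (simp add: alg_components_def)
qed

lemma proj_self:
  assumes "x \<in> Ss ! i"
  shows "alg_proj Q Ss i x = x"
proof -
  have x: "x \<in> alg_carrier Q" using assms component_subset i by blast
  have "alg_components Q Ss x ((replicate (length Ss) (alg_zero Q))[i := x])"
    using total_single[OF i x] assms component_ideal i
    by (auto simp: alg_components_def alg_ideal_def nth_list_update)
  from proj_eq[OF x this] show ?thesis using i by simp
qed

lemma proj_mult:
  assumes q: "q \<in> alg_carrier Q" and r: "r \<in> alg_carrier Q"
  shows "alg_proj Q Ss i (alg_mult Q q r) = alg_mult Q (alg_proj Q Ss i q) (alg_proj Q Ss i r)"
proof -
  let ?P = "alg_proj Q Ss i"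
  have Pq: "?P q \<in> alg_carrier Q" using proj_in[OF q] component_subset[OF i] by blast
  have 1: "?P (alg_mult Q q r) = alg_mult Q (?P q) r"
    by (rule proj_commutes[where h = "\<lambda>x. alg_mult Q x r"])
      (use q r component_ideal in \<open>auto simp: distrib_right mult_zero_left mult_closed alg_ideal_def\<close>)
  have 2: "?P (alg_mult Q (?P q) r) = alg_mult Q (?P q) (?P r)"
    by (rule proj_commutes[where h = "\<lambda>x. alg_mult Q (?P q) x"])
      (use Pq r component_ideal in \<open>auto simp: distrib_left mult_zero_right mult_closed alg_ideal_def\<close>)
  show ?thesis using 1 2 proj_self[OF proj_in[OF mult_closed[OF q r]]] by simp
qed

lemma proj_scale:
  assumes q: "q \<in> alg_carrier Q"
  shows "alg_proj Q Ss i (alg_scale Q c q) = alg_scale Q c (alg_proj Q Ss i q)"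
  by (rule proj_commutes)
    (use q component_ideal in \<open>auto simp: scale_add scale_zero scale_closed alg_ideal_def\<close>)

end

end

context assoc_algebra
begin

section \<open>The quotient by the radical and natural modules as representations\<close>

lemma radical_ideal:
  assumes B: "subalgebra B"
  shows "alg_ideal (sub_alg B) (radical B)"
proof -
  let ?G = "\<Union>{I. alg_ideal (sub_alg B) I \<and> nilpotent_set I}"
  have G: "x \<in> B" "q \<in> B \<Longrightarrow> q * x \<in> ?G \<and> x * q \<in> ?G" if x: "x \<in> ?G" for x q
  proof -
    obtain I where I: "alg_ideal (sub_alg B) I" "nilpotent_set I" "x \<in> I" using x by blast
    then show "x \<in> B" by (auto simp: alg_ideal_def sub_alg_def)
    show "q * x \<in> ?G \<and> x * q \<in> ?G" if "q \<in> B"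
      using I that by (auto simp: alg_ideal_def sub_alg_def intro!: exI[of _ I])
  qed
  have "radical B \<subseteq> B"
    unfolding radical_def by (rule span_minimal) (use G(1) subalgebraD(1)[OF B] in auto)
  moreover have "q * x \<in> radical B \<and> x * q \<in> radical B" if "q \<in> B" "x \<in> radical B" for q x
    using that(2) unfolding radical_def
  proof (induction x rule: span_induct_alt)
    case base then show ?case by (simp add: span_zero)
  next
    case (step c y z)
    have "q * y \<in> span ?G" "y * q \<in> span ?G"
      using G(2)[OF step(1) that(1)] by (simp_all only: span_base)
    with step show ?case
      by (simp add: distrib_left distrib_right scale_mult_left scale_mult_right span_add span_scale)
  qed
  ultimately show ?thesis
    by (auto simp: alg_ideal_def sub_alg_def radical_def span_zero span_add span_scale)
qed

text \<open>All cosets in each defining union coincide, so the union collapses. For products the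
  representatives must lie in \<open>B\<close>, since \<open>R\<close> absorbs only multiplication
  by elements of \<open>B\<close>.\<close>

lemma quot_alg_ops:
  assumes B: "subalgebra B" and R: "alg_ideal (sub_alg B) R"
  shows quot_carrier: "alg_carrier (quot_alg B R) = coset R ` B"
    and quot_zero: "alg_zero (quot_alg B R) = coset R 0"
    and quot_add: "alg_add (quot_alg B R) (coset R x) (coset R y) = coset R (x + y)"
    and quot_mult: "\<lbrakk>x \<in> B; y \<in> B\<rbrakk> \<Longrightarrow> alg_mult (quot_alg B R) (coset R x) (coset R y) = coset R (x * y)"
    and quot_scale: "alg_scale (quot_alg B R) c (coset R x) = coset R (c *s x)"
proof -
  have R0: "0 \<in> R" and Radd: "\<And>r s. r \<in> R \<Longrightarrow> s \<in> R \<Longrightarrow> r + s \<in> R"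
    and Rsc: "\<And>c r. r \<in> R \<Longrightarrow> c *s r \<in> R"
    and Rm: "\<And>b r. b \<in> B \<Longrightarrow> r \<in> R \<Longrightarrow> b * r \<in> R \<and> r * b \<in> R" and RB: "R \<subseteq> B"
    using R by (auto simp: alg_ideal_def sub_alg_def)
  have Rsub: "- r \<in> R" if "r \<in> R" for r using Rsc[OF that, of "- 1"] by simp
  have eq: "coset R (x + r) = coset R x" if "r \<in> R" for x r
  proof
    show "coset R (x + r) \<subseteq> coset R x" using that Radd by (auto simp: coset_def add.assoc)
    show "coset R x \<subseteq> coset R (x + r)"
    proof
      fix u assume "u \<in> coset R x"
      then obtain s where s: "s \<in> R" "u = x + s" by (auto simp: coset_def)
      then have "u = (x + r) + (- r + s)" by simp
      with Radd[OF Rsub[OF that] s(1)] show "u \<in> coset R (x + r)" unfolding coset_def by blast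
    qed
  qed
  show "alg_carrier (quot_alg B R) = coset R ` B" by (simp add: quot_alg_def)
  show "alg_zero (quot_alg B R) = coset R 0" by (simp add: quot_alg_def coset_def)
  have self: "x \<in> coset R x" for x using R0 by (force simp: coset_def)
  have "coset R (u + v) = coset R (x + y)" if uv: "u \<in> coset R x" "v \<in> coset R y" for u v
  proof -
    from uv obtain r s where "u = x + r" "v = y + s" "r \<in> R" "s \<in> R" by (auto simp: coset_def)
    then have "u + v = (x + y) + (r + s)" "r + s \<in> R" using Radd by auto
    then show ?thesis using eq by metis
  qed
  then show "alg_add (quot_alg B R) (coset R x) (coset R y) = coset R (x + y)"
    unfolding quot_alg_def alg.simps by (intro UN_constant_eq[OF self] ballI)
  have "coset R (c *s u) = coset R (c *s x)" if u: "u \<in> coset R x" for u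
  proof -
    from u obtain r where "u = x + r" "r \<in> R" by (auto simp: coset_def)
    then show ?thesis using eq[OF Rsc] by (simp add: scale_right_distrib)
  qed
  then show "alg_scale (quot_alg B R) c (coset R x) = coset R (c *s x)"
    unfolding quot_alg_def alg.simps by (intro UN_constant_eq[OF self] ballI)
  assume xy: "x \<in> B" "y \<in> B"
  have "coset R (u * v) = coset R (x * y)" if uv: "u \<in> coset R x" "v \<in> coset R y" for u v
  proof -
    from uv obtain r s where rs: "u = x + r" "v = y + s" "r \<in> R" "s \<in> R" by (auto simp: coset_def)
    then have "u * v = x * y + (x * s + (r * y + r * s))" by (simp add: distrib_left distrib_right add.assoc)
    moreover have "x * s + (r * y + r * s) \<in> R" using rs xy Rm RB by (intro Radd) auto
    ultimately show ?thesis by (simp only: eq)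
  qed
  then show "alg_mult (quot_alg B R) (coset R x) (coset R y) = coset R (x * y)"
    unfolding quot_alg_def alg.simps by (intro UN_constant_eq[OF self] ballI)
qed

lemma carrier_algebra_quot:
  assumes B: "subalgebra B" and R: "alg_ideal (sub_alg B) R"
  shows "carrier_algebra (quot_alg B R)"
proof -
  note ops = quot_alg_ops[OF B R]
  have cl: "0 \<in> B" "\<And>x y. x \<in> B \<Longrightarrow> y \<in> B \<Longrightarrow> x + y \<in> B" "\<And>x y. x \<in> B \<Longrightarrow> y \<in> B \<Longrightarrow> x * y \<in> B"
    "\<And>c x. x \<in> B \<Longrightarrow> c *s x \<in> B"
    using B by (auto simp: subalgebra_def subspace_def)
  show ?thesis
    by unfold_locales
      (auto simp: ops cl algebra_simps scale_right_distrib)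
qed

text \<open>
  The natural module of a component is multiplicative because the projection onto it is: for
  the projection \<open>P\<close> onto an ideal, \<open>P (q r) = P q * r = P (P q * r) = P q * P r\<close>.
\<close>

lemma natural_module_hom:
  assumes B: "subalgebra B" and nat: "natural_module B n \<rho>"
  shows natural_module_carrier: "x \<in> B \<Longrightarrow> \<rho> x \<in> carrier_mat n n"
    and natural_module_add: "\<lbrakk>x \<in> B; y \<in> B\<rbrakk> \<Longrightarrow> \<rho> (x + y) = \<rho> x + \<rho> y"
    and natural_module_scale: "x \<in> B \<Longrightarrow> \<rho> (c *s x) = c \<cdot>\<^sub>m \<rho> x"
    and natural_module_mult: "\<lbrakk>x \<in> B; y \<in> B\<rbrakk> \<Longrightarrow> \<rho> (x * y) = \<rho> x * \<rho> y"
    and natural_module_nonzero: "\<exists>x\<in>B. \<rho> x \<noteq> 0\<^sub>m n n"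
proof -
  let ?R = "radical B"
  let ?Q = "semisimple_quot B"
  obtain Ss i \<phi> where D: "simple_decomposition ?Q Ss" and i: "i < length Ss"
    and iso: "alg_iso (?Q\<lparr>alg_carrier := Ss ! i\<rparr>) (mat_alg n) \<phi>"
    and \<rho>: "\<And>b. b \<in> B \<Longrightarrow> \<rho> b = \<phi> (alg_proj ?Q Ss i (coset ?R b))"
    using nat unfolding natural_module_def by blast
  note ops = quot_alg_ops[OF B radical_ideal[OF B]]
  interpret Q: carrier_algebra ?Q by (rule carrier_algebra_quot[OF B radical_ideal[OF B]])
  define P where "P b = alg_proj ?Q Ss i (coset ?R b)" for b
  have car: "coset ?R b \<in> alg_carrier ?Q" if "b \<in> B" for b using that by (simp add: ops)
  have PB: "P b \<in> Ss ! i" if "b \<in> B" for b unfolding P_def by (rule Q.proj_in[OF D i car[OF that]])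
  have bij: "bij_betw \<phi> (Ss ! i) (carrier_mat n n)"
    and \<phi>_add: "\<And>s t. s \<in> Ss ! i \<Longrightarrow> t \<in> Ss ! i \<Longrightarrow> \<phi> (alg_add ?Q s t) = \<phi> s + \<phi> t"
    and \<phi>_mult: "\<And>s t. s \<in> Ss ! i \<Longrightarrow> t \<in> Ss ! i \<Longrightarrow> \<phi> (alg_mult ?Q s t) = \<phi> s * \<phi> t"
    and \<phi>_scale: "\<And>c s. s \<in> Ss ! i \<Longrightarrow> \<phi> (alg_scale ?Q c s) = c \<cdot>\<^sub>m \<phi> s"
    using iso by (auto simp: alg_iso_def mat_alg_def)
  have \<phi>car: "\<phi> s \<in> carrier_mat n n" if "s \<in> Ss ! i" for s using bij that by (auto simp: bij_betw_def)
  show "x \<in> B \<Longrightarrow> \<rho> x \<in> carrier_mat n n" for x using \<rho> \<phi>car PB P_def by simp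
  have cl: "\<And>x y. x \<in> B \<Longrightarrow> y \<in> B \<Longrightarrow> x + y \<in> B" "\<And>x y. x \<in> B \<Longrightarrow> y \<in> B \<Longrightarrow> x * y \<in> B"
    "\<And>c x. x \<in> B \<Longrightarrow> c *s x \<in> B"
    using B by (auto simp: subalgebra_def subspace_def)
  show "\<rho> (x + y) = \<rho> x + \<rho> y" if "x \<in> B" "y \<in> B" for x y
    using that Q.proj_add[OF D i car car] PB \<phi>_add by (simp add: \<rho> cl P_def flip: ops(3))
  show "\<rho> (x * y) = \<rho> x * \<rho> y" if "x \<in> B" "y \<in> B" for x y
    using that Q.proj_mult[OF D i car car] PB \<phi>_mult by (simp add: \<rho> cl P_def flip: ops(4))
  show "\<rho> (c *s x) = c \<cdot>\<^sub>m \<rho> x" if "x \<in> B" for c x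
    using that Q.proj_scale[OF D i car] PB \<phi>_scale by (simp add: \<rho> cl P_def flip: ops(5))
  have id: "alg_ideal ?Q (Ss ! i)" and simp: "alg_simple (?Q\<lparr>alg_carrier := Ss ! i\<rparr>)"
    using D i by (auto simp: simple_decomposition_def)
  \<comment> \<open>A simple component has a nonzero product; its image under the injective
    \<open>\<phi>\<close> shows that the module is nonzero.\<close>
  obtain s t where st: "s \<in> Ss ! i" "t \<in> Ss ! i" "alg_mult ?Q s t \<noteq> alg_zero ?Q"
    using simp by (auto simp: alg_simple_def)
  have z: "alg_zero ?Q \<in> Ss ! i" using id by (simp add: alg_ideal_def)
  \<comment> \<open>Preservation of zero is not a clause of \<open>alg_iso\<close>; it follows by
    scaling with 0.\<close>
  have "\<phi> (alg_zero ?Q) = 0 \<cdot>\<^sub>m \<phi> (alg_zero ?Q)" using \<phi>_scale[OF z, of 0] by (simp add: Q.scale_zero)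
  also have "\<dots> = 0\<^sub>m n n" using \<phi>car[OF z] by (intro eq_matI) auto
  finally have \<phi>0: "\<phi> (alg_zero ?Q) = 0\<^sub>m n n" .
  define q where "q = alg_mult ?Q s t"
  have q: "q \<in> Ss ! i" "q \<noteq> alg_zero ?Q" "q \<in> alg_carrier ?Q"
    using id st Q.mult_closed by (auto simp: q_def alg_ideal_def)
  then have "\<phi> q \<noteq> 0\<^sub>m n n" using bij z \<phi>0 by (metis bij_betw_def inj_onD)
  moreover obtain b where b: "b \<in> B" "q = coset ?R b" using q(3) by (auto simp: ops)
  moreover have "\<rho> b = \<phi> q" using \<rho>[OF b(1)] b(2) Q.proj_self[OF D i q(1)] by simp
  ultimately show "\<exists>x\<in>B. \<rho> x \<noteq> 0\<^sub>m n n" by auto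
qed

text \<open>The kernel is a subspace containing every \<open>x * e * y\<close> as soon as it
  contains \<open>e\<close>, and a natural module is not zero on all of \<open>B\<close>.\<close>

lemma natural_module_generator_nonzero:
  assumes B: "subalgebra B" and nat: "natural_module B n \<rho>"
    and e: "e \<in> B" and gen: "B \<subseteq> span {x * e * y | x y. x \<in> B \<and> y \<in> B}"
  shows "\<rho> e \<noteq> 0\<^sub>m n n"
proof
  assume zero: "\<rho> e = 0\<^sub>m n n"
  note hom = natural_module_hom[OF B nat]
  have B0: "0 \<in> B" using subalgebraD(1)[OF B] by (rule subspace_0)
  have "subspace {b \<in> B. \<rho> b = 0\<^sub>m n n}"
    unfolding subspace_def
  proof (intro conjI ballI allI)
    have "\<rho> 0 = 0 \<cdot>\<^sub>m \<rho> 0" using hom(3)[OF B0, of 0] by simp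
    also have "\<dots> = 0\<^sub>m n n" using hom(1)[OF B0] by (intro eq_matI) auto
    finally show "0 \<in> {b \<in> B. \<rho> b = 0\<^sub>m n n}" using B0 by simp
  qed (use hom subalgebraD(1)[OF B] in \<open>auto simp: subspace_def\<close>)
  then have "span {x * e * y | x y. x \<in> B \<and> y \<in> B} \<subseteq> {b \<in> B. \<rho> b = 0\<^sub>m n n}"
  proof (rule span_minimal[rotated])
    have "\<rho> (x * e * y) = 0\<^sub>m n n" "x * e * y \<in> B" if "x \<in> B" "y \<in> B" for x y
    proof -
      have xe: "x * e \<in> B" using that(1) e by (rule subalgebraD(2)[OF B])
      then show "x * e * y \<in> B" using that(2) by (rule subalgebraD(2)[OF B])
      show "\<rho> (x * e * y) = 0\<^sub>m n n"
        using hom(4)[OF xe that(2)] hom(4)[OF that(1) e] hom(1)[OF that(1)] hom(1)[OF that(2)] zero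
        by simp
    qed
    then show "{x * e * y | x y. x \<in> B \<and> y \<in> B} \<subseteq> {b \<in> B. \<rho> b = 0\<^sub>m n n}" by auto
  qed
  with gen hom(5) show False by blast
qed

end

section \<open>The conical local system\<close>

text \<open>If \<open>m < n\<close>, padding with zeros gives square matrices with the same product.
  A right inverse is then a left inverse, but row \<open>m\<close> of the padded \<open>B'\<close>
  is zero.\<close>

lemma le_of_mat_right_inverse:
  fixes A B :: "'f::field mat"
  assumes A: "A \<in> carrier_mat n m" and B: "B \<in> carrier_mat m n" and AB: "A * B = 1\<^sub>m n"
  shows "n \<le> m"
proof (rule ccontr)
  assume "\<not> n \<le> m"
  define A' where "A' = mat n n (\<lambda>(i, j). if j < m then A $$ (i, j) else 0)"
  define B' where "B' = mat n n (\<lambda>(i, j). if i < m then B $$ (i, j) else 0)"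
  have car: "A' \<in> carrier_mat n n" "B' \<in> carrier_mat n n" by (auto simp: A'_def B'_def)
  have "A' * B' = A * B"
  proof (rule eq_matI)
    fix i j assume "i < dim_row (A * B)" "j < dim_col (A * B)"
    then have ij: "i < n" "j < n" using A B by auto
    have "(A' * B') $$ (i, j) = (\<Sum>k = 0..<n. A' $$ (i, k) * B' $$ (k, j))"
      using ij car by (auto simp: scalar_prod_def)
    also have "\<dots> = (\<Sum>k = 0..<m. A $$ (i, k) * B $$ (k, j))"
      by (rule sum.mono_neutral_cong_right)
        (use \<open>\<not> n \<le> m\<close> ij in \<open>auto simp: A'_def B'_def\<close>)
    also have "\<dots> = (A * B) $$ (i, j)" using ij A B by (auto simp: scalar_prod_def)
    finally show "(A' * B') $$ (i, j) = (A * B) $$ (i, j)" .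
  qed (use A B car in auto)
  then have "B' * A' = 1\<^sub>m n" using mat_mult_left_right_inverse[OF car] AB by simp
  then have "(B' * A') $$ (m, m) = 1" using \<open>\<not> n \<le> m\<close> by simp
  moreover have "(B' * A') $$ (m, m) = (\<Sum>k = 0..<n. B' $$ (m, k) * A' $$ (k, m))"
    using car \<open>\<not> n \<le> m\<close> by (auto simp: scalar_prod_def)
  moreover have "\<dots> = 0" using \<open>\<not> n \<le> m\<close> by (intro sum.neutral) (auto simp: B'_def)
  ultimately show False by simp
qed

locale matrix_units = assoc_algebra scale
  for scale :: "'f::field \<Rightarrow> 'a::ring \<Rightarrow> 'a" (infixr \<open>*s\<close> 75) +
  fixes h :: 'a and N :: nat and v w :: "nat \<Rightarrow> 'a"
  assumes dual: "dual_system h N v w" and N: "N > 0"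
begin

section \<open>The matrix subalgebra spanned by the units\<close>

lemma h: "h \<noteq> 0" "h * h = h"
  and vh: "i < N \<Longrightarrow> v i * h = v i"
  and hw: "i < N \<Longrightarrow> h * w i = w i"
  and wv: "\<lbrakk>i < N; j < N\<rbrakk> \<Longrightarrow> w i * v j = (if i = j then h else 0)"
  using dual by (auto simp: dual_system_def)

definition E :: "nat \<Rightarrow> nat \<Rightarrow> 'a" where "E i j = v i * w j"

definition S :: "'a set" where "S = span ((\<lambda>(i, j). E i j) ` ({..<N} \<times> {..<N}))"

definition of_mat :: "'f mat \<Rightarrow> 'a" where
  "of_mat M = (\<Sum>i<N. \<Sum>j<N. M $$ (i, j) *s E i j)"

lemma E_mult:
  assumes "i < N" "j < N" "k < N" "l < N"
  shows "E i j * E k l = (if j = k then E i l else 0)"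
proof -
  have "E i j * E k l = v i * (w j * v k) * w l" by (simp add: E_def mult.assoc)
  then show ?thesis using wv vh assms by (simp add: E_def)
qed

lemma E_in_S: "\<lbrakk>i < N; j < N\<rbrakk> \<Longrightarrow> E i j \<in> S"
  unfolding S_def by (rule span_base) auto

lemma of_mat_in_S: "of_mat M \<in> S"
  unfolding of_mat_def
  by (intro subspace_sum subspace_scale) (auto simp: E_in_S, auto simp: S_def)

lemma of_mat_add:
  "\<lbrakk>M \<in> carrier_mat N N; M' \<in> carrier_mat N N\<rbrakk> \<Longrightarrow> of_mat (M + M') = of_mat M + of_mat M'"
  by (simp add: of_mat_def scale_left_distrib sum.distrib)

lemma of_mat_smult: "M \<in> carrier_mat N N \<Longrightarrow> of_mat (c \<cdot>\<^sub>m M) = c *s of_mat M"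
  by (simp add: of_mat_def scale_sum_right)

lemma of_mat_unit:
  assumes "i < N" "j < N"
  shows "of_mat (mat N N (\<lambda>p. if p = (i, j) then 1 else 0)) = E i j"
proof -
  let ?M = "mat N N (\<lambda>p. if p = (i, j) then 1 else 0)"
  have "(\<Sum>l<N. ?M $$ (k, l) *s E k l) = (if k = i then E i j else 0)" if "k < N" for k
  proof -
    have "(\<Sum>l<N. ?M $$ (k, l) *s E k l) = (\<Sum>l<N. if l = j then if k = i then E i j else 0 else 0)"
      by (rule sum.cong) (use that in auto)
    with assms show ?thesis by simp
  qed
  then have "of_mat ?M = (\<Sum>k<N. if k = i then E i j else 0)"
    unfolding of_mat_def by (intro sum.cong) auto
  with assms show ?thesis by simp
qed

lemma of_mat_image: "of_mat ` carrier_mat N N = S"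
proof
  show "of_mat ` carrier_mat N N \<subseteq> S" using of_mat_in_S by blast
  have "subspace (of_mat ` carrier_mat N N)"
    unfolding subspace_def
  proof (intro conjI ballI allI)
    have "of_mat (0\<^sub>m N N) = 0" by (simp add: of_mat_def)
    then show "0 \<in> of_mat ` carrier_mat N N" by force
  next
    fix x y assume "x \<in> of_mat ` carrier_mat N N" "y \<in> of_mat ` carrier_mat N N"
    then obtain M M' where "M \<in> carrier_mat N N" "M' \<in> carrier_mat N N" "x = of_mat M" "y = of_mat M'"
      by blast
    then show "x + y \<in> of_mat ` carrier_mat N N" by (metis of_mat_add add_carrier_mat imageI)
  next
    fix c x assume "x \<in> of_mat ` carrier_mat N N"
    then obtain M where "M \<in> carrier_mat N N" "x = of_mat M" by blast
    then show "c *s x \<in> of_mat ` carrier_mat N N" by (metis of_mat_smult smult_carrier_mat imageI)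
  qed
  moreover have "E i j \<in> of_mat ` carrier_mat N N" if "i < N" "j < N" for i j
    using of_mat_unit[OF that] by (metis mat_carrier imageI)
  ultimately show "S \<subseteq> of_mat ` carrier_mat N N"
    unfolding S_def by (intro span_minimal) auto
qed

text \<open>Pairing with the dual system extracts single entries; injectivity of
  \<open>of_mat\<close> and simplicity of \<open>S\<close> both rest on this.\<close>

lemma of_mat_coeff:
  assumes "i < N" "j < N"
  shows "w i * of_mat M * v j = M $$ (i, j) *s h"
proof -
  have "w i * of_mat M * v j =
      (\<Sum>k<N. \<Sum>l<N. M $$ (k, l) *s (w i * v k * (w l * v j)))"
    by (simp add: of_mat_def sum_distrib_left sum_distrib_right scale_mult_left scale_mult_right
        E_def mult.assoc)
  also have "\<dots> = (\<Sum>k<N. if k = i then M $$ (i, j) *s h else 0)"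
  proof (rule sum.cong[OF refl])
    fix k assume "k \<in> {..<N}"
    then have "(\<Sum>l<N. M $$ (k, l) *s (w i * v k * (w l * v j))) =
        (\<Sum>l<N. if l = j then if k = i then M $$ (i, j) *s h else 0 else 0)"
      using assms h by (intro sum.cong) (auto simp: wv)
    with assms show "(\<Sum>l<N. M $$ (k, l) *s (w i * v k * (w l * v j))) =
        (if k = i then M $$ (i, j) *s h else 0)" by simp
  qed
  also have "\<dots> = M $$ (i, j) *s h" using assms by simp
  finally show ?thesis .
qed

lemma of_mat_inj: "inj_on of_mat (carrier_mat N N)"
proof (rule inj_onI)
  fix M M' assume M: "M \<in> carrier_mat N N" "M' \<in> carrier_mat N N" "of_mat M = of_mat M'"
  show "M = M'"
  proof (rule eq_matI)
    fix i j assume "i < dim_row M'" "j < dim_col M'"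
    then have "i < N" "j < N" using M by auto
    then have "M $$ (i, j) *s h = M' $$ (i, j) *s h" using of_mat_coeff M(3) by metis
    then show "M $$ (i, j) = M' $$ (i, j)" using h by simp
  qed (use M in auto)
qed

lemma of_mat_mult:
  assumes M: "M \<in> carrier_mat N N" "M' \<in> carrier_mat N N"
  shows "of_mat (M * M') = of_mat M * of_mat M'"
proof -
  have "of_mat M * of_mat M' =
      (\<Sum>i<N. \<Sum>j<N. \<Sum>k<N. \<Sum>l<N. (M $$ (i, j) * M' $$ (k, l)) *s (E i j * E k l))"
  proof -
    have "(M $$ (i, j) *s E i j) * of_mat M' =
        (\<Sum>k<N. \<Sum>l<N. (M $$ (i, j) * M' $$ (k, l)) *s (E i j * E k l))" for i j
      by (simp add: of_mat_def sum_distrib_left scale_mult_left scale_mult_right mult.commute)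
    then show ?thesis by (simp add: of_mat_def[of M] sum_distrib_right)
  qed
  also have "\<dots> = (\<Sum>i<N. \<Sum>j<N. \<Sum>k<N. if k = j then \<Sum>l<N. (M $$ (i, j) * M' $$ (k, l)) *s E i l else 0)"
    by (intro sum.cong refl) (auto simp: E_mult intro!: sum.cong sum.neutral)
  also have "\<dots> = (\<Sum>i<N. \<Sum>j<N. \<Sum>l<N. (M $$ (i, j) * M' $$ (j, l)) *s E i l)" by simp
  also have "\<dots> = (\<Sum>i<N. \<Sum>l<N. (\<Sum>j<N. M $$ (i, j) * M' $$ (j, l)) *s E i l)"
    unfolding scale_sum_left by (rule sum.cong[OF refl], rule sum.swap)
  also have "\<dots> = of_mat (M * M')"
    unfolding of_mat_def
    by (intro sum.cong refl)
      (use M in \<open>auto simp: scalar_prod_def atLeast0LessThan\<close>)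
  finally show ?thesis by simp
qed

lemma subalgebra_S: "subalgebra S"
  unfolding subalgebra_def
proof (intro conjI ballI)
  show "subspace S" by (simp add: S_def)
  fix x y assume "x \<in> S" "y \<in> S"
  then obtain M M' where "M \<in> carrier_mat N N" "M' \<in> carrier_mat N N" "x = of_mat M" "y = of_mat M'"
    using of_mat_image by blast
  then have "x * y = of_mat (M * M')" by (simp add: of_mat_mult)
  then show "x * y \<in> S" using of_mat_in_S by simp
qed

lemma fin_dim_S: "fin_dim S"
  unfolding fin_dim_def S_def
  by (rule exI[of _ "(\<lambda>(i, j). E i j) ` ({..<N} \<times> {..<N})"]) simp

abbreviation "e \<equiv> E 0 0"

lemma e: "e \<in> S" "e * e = e" "e \<noteq> 0"
proof -
  show "e \<in> S" "e * e = e" using E_in_S E_mult N by auto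
  have "w 0 * e * v 0 = (w 0 * v 0) * (w 0 * v 0)" by (simp add: E_def mult.assoc)
  then have "w 0 * e * v 0 = h" using wv[of 0 0] N h by simp
  then show "e \<noteq> 0" using h by auto
qed

lemma E_factor: "\<lbrakk>i < N; j < N\<rbrakk> \<Longrightarrow> E i j = E i 0 * e * E 0 j"
  using N by (simp add: E_mult)

text \<open>Matrix units isolate a nonzero entry of a member of \<open>I\<close> and move it to any
  position, so all units lie in \<open>I\<close>.\<close>

lemma ideal_of_S:
  assumes "alg_ideal (sub_alg S) I"
  shows "I = {0} \<or> I = S"
proof (rule disjCI)
  assume "I \<noteq> S"
  have I: "I \<subseteq> S" "subspace I" "\<And>q x. q \<in> S \<Longrightarrow> x \<in> I \<Longrightarrow> q * x \<in> I \<and> x * q \<in> I"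
    using assms by (auto simp: alg_ideal_def sub_alg_def subspace_def)
  show "I = {0}"
  proof (rule ccontr)
    assume "I \<noteq> {0}"
    then obtain z where z: "z \<in> I" "z \<noteq> 0" using subspace_0[OF I(2)] by blast
    then obtain M where M: "M \<in> carrier_mat N N" "z = of_mat M" using I(1) of_mat_image by blast
    have "\<exists>i<N. \<exists>j<N. M $$ (i, j) \<noteq> 0"
    proof (rule ccontr)
      assume "\<not> ?thesis"
      then have "of_mat M = 0" unfolding of_mat_def by (intro sum.neutral ballI) auto
      with z M show False by simp
    qed
    then obtain i j where ij: "i < N" "j < N" "M $$ (i, j) \<noteq> 0" by blast
    have "E k l \<in> I" if "k < N" "l < N" for k l
    proof -
      have "E k i * z * E j l \<in> I" using I(3) E_in_S z(1) ij that by blast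
      moreover have "E k i * z * E j l = v k * (w i * z * v j) * w l" by (simp add: E_def mult.assoc)
      moreover have "\<dots> = M $$ (i, j) *s E k l"
        using of_mat_coeff[OF ij(1,2)] M(2) vh that by (simp add: E_def scale_mult_left scale_mult_right)
      ultimately have "inverse (M $$ (i, j)) *s (M $$ (i, j) *s E k l) \<in> I"
        using subspace_scale[OF I(2)] by metis
      then show ?thesis using ij(3) by simp
    qed
    then have "S \<subseteq> I" unfolding S_def by (intro span_minimal I(2)) auto
    with I(1) \<open>I \<noteq> S\<close> show False by blast
  qed
qed

lemma simple_S: "alg_simple (sub_alg S)"
  unfolding alg_simple_def using ideal_of_S e by (auto simp: sub_alg_def intro!: bexI[of _ e])

text \<open>The idempotent \<open>e\<close> lies in every power of \<open>S\<close>, so the only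
  nilpotent ideal is zero.\<close>

lemma radical_S: "radical S = {0}"
proof -
  have "I \<subseteq> {0}" if I: "alg_ideal (sub_alg S) I" "nilpotent_set I" for I
  proof -
    have "e \<in> set_pow S k" for k
    proof (induction k)
      case (Suc k) then show ?case using set_prodI[OF e(1)] e(2) by force
    qed (simp add: e)
    then have "I \<noteq> S" using I(2) e(3) unfolding nilpotent_set_def by blast
    with ideal_of_S[OF I(1)] show ?thesis by blast
  qed
  then have "radical S \<subseteq> {0}" unfolding radical_def by (intro span_minimal) auto
  then show ?thesis using span_zero unfolding radical_def by blast
qed

section \<open>The quotient by the zero radical and the rank of the matrix subalgebra\<close>

abbreviation Q :: "('f, 'a set) alg" where "Q \<equiv> quot_alg S {0}"

lemma coset_zero: "coset {0} x = {x}"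
  by (simp add: coset_def)

lemma ideal_zero_S: "alg_ideal (sub_alg S) {0}"
  using subalgebra_S subalgebraD(1) subspace_0 by (auto simp: alg_ideal_def sub_alg_def)

lemmas Q_ops = quot_alg_ops[OF subalgebra_S ideal_zero_S, unfolded coset_zero]

text \<open>Cosets of \<open>{0}\<close> are singletons, so an ideal pulls back to \<open>S\<close>
  along the map from \<open>x\<close> to \<open>{x}\<close>.\<close>

lemma ideal_of_Q:
  assumes "alg_ideal Q I"
  shows "I = {alg_zero Q} \<or> I = alg_carrier Q"
proof -
  have I: "I \<subseteq> (\<lambda>x. {x}) ` S" using assms by (auto simp: alg_ideal_def Q_ops)
  have sub: "x \<in> S" if "{x} \<in> I" for x using I that by auto
  have "{0} \<in> I" using assms by (simp add: alg_ideal_def Q_ops)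
  moreover have "{x + y} \<in> I" if "{x} \<in> I" "{y} \<in> I" for x y
    using assms that Q_ops(3)[of x y] unfolding alg_ideal_def by metis
  moreover have "{c *s x} \<in> I" if "{x} \<in> I" for c x
    using assms that Q_ops(5)[of c x] unfolding alg_ideal_def by metis
  moreover have "{q * x} \<in> I \<and> {x * q} \<in> I" if "q \<in> S" "{x} \<in> I" for q x
  proof -
    have "alg_mult Q {q} {x} \<in> I \<and> alg_mult Q {x} {q} \<in> I"
      using assms that by (simp add: alg_ideal_def Q_ops(1))
    then show ?thesis using Q_ops(4) that sub by metis
  qed
  ultimately have "alg_ideal (sub_alg S) {x. {x} \<in> I}"
    using sub by (auto simp: alg_ideal_def sub_alg_def)
  then have "{x. {x} \<in> I} = {0} \<or> {x. {x} \<in> I} = S" by (rule ideal_of_S)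
  moreover have "I = (\<lambda>x. {x}) ` {x. {x} \<in> I}" using I by blast
  ultimately show ?thesis by (auto simp: Q_ops)
qed

lemma simple_decomposition_Q: "simple_decomposition Q [alg_carrier Q]"
proof -
  interpret Q: carrier_algebra Q by (rule carrier_algebra_quot[OF subalgebra_S ideal_zero_S])
  have "alg_ideal Q (alg_carrier Q)"
    by (simp add: alg_ideal_def Q.zero_closed Q.add_closed Q.scale_closed Q.mult_closed)
  moreover have "alg_simple Q"
    unfolding alg_simple_def using ideal_of_Q
    by (auto simp: Q_ops e intro!: bexI[of _ e])
  moreover have "\<exists>!ss. alg_components Q [alg_carrier Q] q ss" if "q \<in> alg_carrier Q" for q
    by (rule ex1I[of _ "[q]"])
      (use that in \<open>auto simp: alg_components_def Q.add_zero length_Suc_conv\<close>)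
  ultimately show ?thesis by (simp add: simple_decomposition_def)
qed

lemma alg_iso_Q: "alg_iso Q (mat_alg N) (\<lambda>X. inv_into (carrier_mat N N) of_mat (the_elem X))"
proof -
  let ?f = "inv_into (carrier_mat N N) of_mat"
  have inv: "?f (of_mat M) = M" if "M \<in> carrier_mat N N" for M
    using inv_into_f_f[OF of_mat_inj that] .
  have bij: "bij_betw ?f S (carrier_mat N N)"
    using bij_betw_inv_into[of of_mat "carrier_mat N N" S] of_mat_inj of_mat_image
    by (simp add: bij_betw_def)
  moreover have "bij_betw the_elem ((\<lambda>x. {x}) ` S) S"
    by (rule bij_betwI[of _ _ _ "\<lambda>x. {x}"]) auto
  ultimately have "bij_betw (\<lambda>X. ?f (the_elem X)) ((\<lambda>x. {x}) ` S) (carrier_mat N N)"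
    using bij_betw_trans[of the_elem _ S ?f] by (simp add: o_def)
  moreover have "?f (x + y) = ?f x + ?f y" "?f (x * y) = ?f x * ?f y" "?f (c *s x) = c \<cdot>\<^sub>m ?f x"
    if xy: "x \<in> S" "y \<in> S" for x y c
  proof -
    have "x \<in> of_mat ` carrier_mat N N" "y \<in> of_mat ` carrier_mat N N"
      using xy by (simp_all add: of_mat_image)
    then obtain M M' where M: "M \<in> carrier_mat N N" "M' \<in> carrier_mat N N" "x = of_mat M" "y = of_mat M'"
      by blast
    then have "?f (of_mat (M + M')) = M + M'" "?f (of_mat (M * M')) = M * M'"
        "?f (of_mat (c \<cdot>\<^sub>m M)) = c \<cdot>\<^sub>m M"
      by (auto intro!: inv)
    with M inv show "?f (x + y) = ?f x + ?f y" "?f (x * y) = ?f x * ?f y" "?f (c *s x) = c \<cdot>\<^sub>m ?f x"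
      by (simp_all add: of_mat_add of_mat_mult of_mat_smult)
  qed
  ultimately show ?thesis by (auto simp: alg_iso_def mat_alg_def Q_ops)
qed

text \<open>
  For an isomorphism \<open>\<psi>\<close> onto \<open>m \<times> m\<close> matrices choose \<open>u\<close> and \<open>r\<close> with \<open>(\<psi> e u) $ r \<noteq> 0\<close>. Row \<open>r\<close>
  of the matrices \<open>\<psi> (E 0 i)\<close> and the columns \<open>\<psi> (E j 0) u\<close> form matrices of sizes \<open>N \<times> m\<close> and
  \<open>m \<times> N\<close> whose product is a nonzero multiple of the identity.
\<close>

lemma alg_iso_size:
  assumes iso: "alg_iso Q (mat_alg m) \<phi>"
  shows "N \<le> m"
proof -
  define \<psi> where "\<psi> x = \<phi> {x}" for x
  have bij: "bij_betw \<phi> ((\<lambda>x. {x}) ` S) (carrier_mat m m)"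
    and mult: "\<And>x y. x \<in> S \<Longrightarrow> y \<in> S \<Longrightarrow> \<psi> (x * y) = \<psi> x * \<psi> y"
    and scale: "\<And>c x. x \<in> S \<Longrightarrow> \<psi> (c *s x) = c \<cdot>\<^sub>m \<psi> x"
    using iso by (auto simp: alg_iso_def mat_alg_def Q_ops \<psi>_def)
  have car: "\<psi> x \<in> carrier_mat m m" if "x \<in> S" for x
    using bij that by (auto simp: bij_betw_def \<psi>_def)
  have zero: "\<psi> 0 = 0\<^sub>m m m"
  proof -
    have "\<psi> 0 = 0 \<cdot>\<^sub>m \<psi> e" using scale[OF e(1), of 0] by simp
    also have "\<dots> = 0\<^sub>m m m" using car[OF e(1)] by (intro eq_matI) auto
    finally show ?thesis .
  qed
  have S0: "0 \<in> S" using subalgebra_S subalgebraD(1) subspace_0 by blast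
  have "\<psi> e \<noteq> \<psi> 0" using bij e(1,3) S0 by (auto simp: bij_betw_def \<psi>_def inj_on_def)
  then obtain u where u: "u \<in> carrier_vec m" "\<psi> e *\<^sub>v u \<noteq> 0\<^sub>v m"
    using mat_eq_zeroI[OF car[OF e(1)]] zero by metis
  have "\<exists>r<m. (\<psi> e *\<^sub>v u) $ r \<noteq> 0"
  proof (rule ccontr)
    assume "\<not> ?thesis"
    then have "\<psi> e *\<^sub>v u = 0\<^sub>v m" using car[OF e(1)] by (intro eq_vecI) auto
    with u show False by simp
  qed
  then obtain r where r: "r < m" "(\<psi> e *\<^sub>v u) $ r \<noteq> 0" by blast
  define a where "a = (\<psi> e *\<^sub>v u) $ r"
  define X where "X = mat N m (\<lambda>(i, k). \<psi> (E 0 i) $$ (r, k) / a)"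
  define Y where "Y = mat m N (\<lambda>(k, j). (\<psi> (E j 0) *\<^sub>v u) $ k)"
  have "X * Y = 1\<^sub>m N"
  proof (rule eq_matI)
    fix i j assume "i < dim_row (1\<^sub>m N :: 'f mat)" "j < dim_col (1\<^sub>m N :: 'f mat)"
    then have ij: "i < N" "j < N" by auto
    have c: "\<psi> (E 0 i) \<in> carrier_mat m m" "\<psi> (E j 0) \<in> carrier_mat m m"
      using car E_in_S ij N by auto
    have "(X * Y) $$ (i, j) = (\<Sum>k = 0..<m. \<psi> (E 0 i) $$ (r, k) / a * (\<psi> (E j 0) *\<^sub>v u) $ k)"
      using ij by (simp add: X_def Y_def scalar_prod_def)
    also have "\<dots> = (\<psi> (E 0 i) *\<^sub>v (\<psi> (E j 0) *\<^sub>v u)) $ r / a"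
      using r c by (simp add: scalar_prod_def sum_divide_distrib)
    also have "\<psi> (E 0 i) *\<^sub>v (\<psi> (E j 0) *\<^sub>v u) = \<psi> (E 0 i * E j 0) *\<^sub>v u"
      using mult[of "E 0 i" "E j 0"] assoc_mult_mat_vec[OF c u(1)] E_in_S ij N by simp
    also have "E 0 i * E j 0 = (if i = j then e else 0)" using E_mult ij N by simp
    also have "(\<psi> (if i = j then e else 0) *\<^sub>v u) $ r / a = (if i = j then 1 else 0)"
      using r u(1) by (auto simp: a_def zero scalar_prod_def)
    finally show "(X * Y) $$ (i, j) = 1\<^sub>m N $$ (i, j)" using ij by simp
  qed (auto simp: X_def Y_def)
  then show ?thesis by (rule le_of_mat_right_inverse[rotated 2]) (auto simp: X_def Y_def)
qed

text \<open>A component in any decomposition is a nonzero ideal of the simple algebra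
  \<open>Q\<close>, hence all of \<open>Q\<close>, and \<open>alg_iso_size\<close> bounds the matrix
  size.\<close>

lemma rank_S: "N \<le> rank S"
  unfolding rank_def radical_S
proof (rule cInf_greatest)
  \<comment> \<open>The set must be nonempty, as \<open>Inf {} = 0\<close> would violate the
    bound.\<close>
  have "N \<in> {m. \<exists>Ss T \<phi>. simple_decomposition Q Ss \<and> T \<in> set Ss \<and>
      alg_iso (Q\<lparr>alg_carrier := T\<rparr>) (mat_alg m) \<phi>}"
    by (intro CollectI exI[of _ "[alg_carrier Q]"] exI[of _ "alg_carrier Q"]
        exI[of _ "\<lambda>X. inv_into (carrier_mat N N) of_mat (the_elem X)"] conjI)
      (simp_all add: simple_decomposition_Q alg_iso_Q)
  then show "{m. \<exists>Ss T \<phi>. simple_decomposition Q Ss \<and> T \<in> set Ss \<and>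
      alg_iso (Q\<lparr>alg_carrier := T\<rparr>) (mat_alg m) \<phi>} \<noteq> {}" by blast
next
  fix m assume "m \<in> {m. \<exists>Ss T \<phi>. simple_decomposition Q Ss \<and> T \<in> set Ss \<and>
      alg_iso (Q\<lparr>alg_carrier := T\<rparr>) (mat_alg m) \<phi>}"
  then obtain Ss T \<phi> where T: "simple_decomposition Q Ss" "T \<in> set Ss"
    and iso: "alg_iso (Q\<lparr>alg_carrier := T\<rparr>) (mat_alg m) \<phi>" by blast
  then have "alg_ideal Q T" and simp: "alg_simple (Q\<lparr>alg_carrier := T\<rparr>)"
    by (auto simp: simple_decomposition_def)
  \<comment> \<open>The zero ideal has no nonzero product and so is not simple.\<close>
  moreover have "T \<noteq> {alg_zero Q}"
    using simp subalgebra_S Q_ops(4)[of 0 0] subspace_0[OF subalgebraD(1)[OF subalgebra_S]]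
    by (auto simp: alg_simple_def Q_ops)
  ultimately have "T = alg_carrier Q" using ideal_of_Q by blast
  then show "N \<le> m" using iso alg_iso_size by simp
qed

section \<open>The members B e B of the conical system\<close>

definition e_ideal :: "'a set \<Rightarrow> 'a set" where
  "e_ideal B = span {x * e * y | x y. x \<in> B \<and> y \<in> B}"

lemma e_ideal_mono: "B \<subseteq> C \<Longrightarrow> e_ideal B \<subseteq> e_ideal C"
  unfolding e_ideal_def by (rule span_mono) blast

context
  fixes B assumes B: "subalgebra B" "S \<subseteq> B"
begin

lemma e_ideal_subset: "e_ideal B \<subseteq> B"
  unfolding e_ideal_def
  by (rule span_minimal) (use B e subalgebraD[OF B(1)] in auto)

lemma e_ideal_gen: "\<lbrakk>x \<in> B; y \<in> B\<rbrakk> \<Longrightarrow> x * e * y \<in> e_ideal B"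
  unfolding e_ideal_def by (blast intro: span_base)

lemma e_ideal_absorbs:
  assumes "b \<in> B" "t \<in> e_ideal B" shows "b * t \<in> e_ideal B"
  using assms(2) unfolding e_ideal_def
proof (induction t rule: span_induct_alt)
  case base then show ?case by (simp add: span_zero)
next
  case (step c z t)
  then obtain x y where z: "z = x * e * y" "x \<in> B" "y \<in> B" by blast
  then have "b * z \<in> e_ideal B"
    using e_ideal_gen[of "b * x" y] subalgebraD(2)[OF B(1) assms(1)] by (simp add: mult.assoc)
  with step show ?case
    by (simp add: e_ideal_def distrib_left scale_mult_right span_add span_scale)
qed

lemma subalgebra_e_ideal: "subalgebra (e_ideal B)"
  using e_ideal_absorbs e_ideal_subset by (auto simp: subalgebra_def e_ideal_def)

text \<open>Both factors stay in the ideal because \<open>e\<close> is an idempotent of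
  \<open>B\<close>. The factorization with \<open>e\<close> in the middle shows that
  \<open>e\<close> generates B e B from within; the other one gives perfectness.\<close>

lemma e_ideal_factor:
  assumes "x \<in> B" "y \<in> B"
  shows "x * e \<in> e_ideal B" "e * y \<in> e_ideal B" "x * e * y = (x * e) * e * (e * y)" "x * e * y = (x * e) * (e * y)"
proof -
  have e2: "e * (e * z) = e * z" for z using e(2) by (simp flip: mult.assoc)
  show "x * e \<in> e_ideal B" using e_ideal_gen[OF assms(1), of e] B e by (auto simp: mult.assoc)
  show "e * y \<in> e_ideal B" using e_ideal_gen[OF _ assms(2), of e] B e by auto
  show "x * e * y = (x * e) * e * (e * y)" "x * e * y = (x * e) * (e * y)"
    by (simp_all add: mult.assoc e2)
qed

lemma e_ideal_generated: "e_ideal B \<subseteq> span {x * e * y | x y. x \<in> e_ideal B \<and> y \<in> e_ideal B}"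
proof -
  have "{x * e * y | x y. x \<in> B \<and> y \<in> B} \<subseteq> {x * e * y | x y. x \<in> e_ideal B \<and> y \<in> e_ideal B}"
    using e_ideal_factor by blast
  with e_ideal_def show ?thesis by (rule ord_eq_le_trans[OF _ span_mono])
qed

lemma perfect_e_ideal: "perfect (e_ideal B)"
  unfolding perfect_def
proof
  show "set_prod (e_ideal B) (e_ideal B) \<subseteq> e_ideal B"
    using subalgebraD[OF subalgebra_e_ideal] by (intro set_prod_minimal) auto
  have "x * e * y \<in> set_prod (e_ideal B) (e_ideal B)" if "x \<in> B" "y \<in> B" for x y
    using e_ideal_factor[OF that] set_prodI by metis
  then show "e_ideal B \<subseteq> set_prod (e_ideal B) (e_ideal B)"
    unfolding e_ideal_def[of B] by (intro span_minimal subspace_set_prod) auto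
qed

lemma S_subset_e_ideal: "S \<subseteq> e_ideal B"
  unfolding S_def
proof (rule span_minimal)
  show "subspace (e_ideal B)" by (simp add: e_ideal_def)
  have "E i j \<in> e_ideal B" if "i < N" "j < N" for i j
    using E_factor[OF that] e_ideal_gen[of "E i 0" "E 0 j"] E_in_S N that B(2) by auto
  then show "(\<lambda>(i, j). E i j) ` ({..<N} \<times> {..<N}) \<subseteq> e_ideal B" by auto
qed

text \<open>As a generator of its ideal, \<open>e\<close> acts as a nonzero idempotent, and such an
  element cannot act trivially on all composition factors.\<close>

lemma e_ideal_nontrivial_factor:
  assumes "natural_module (e_ideal B) n \<rho>"
  shows "has_nontrivial_factor S n \<rho>"
proof (rule has_nontrivial_factor_of_idempotent)
  note hom = natural_module_hom[OF subalgebra_e_ideal assms]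
  have eh: "e \<in> e_ideal B" using e S_subset_e_ideal by blast
  show "\<rho> c \<in> carrier_mat n n" if "c \<in> S" for c using hom(1) S_subset_e_ideal that by blast
  show "e \<in> S" by (rule e)
  show "\<rho> e * \<rho> e = \<rho> e" using hom(4)[OF eh eh] e by simp
  show "\<rho> e \<noteq> 0\<^sub>m n n"
    by (rule natural_module_generator_nonzero[OF subalgebra_e_ideal assms eh e_ideal_generated])
qed

end

text \<open>This makes \<open>S\<close> itself a member of the system, as its distinguished
  element.\<close>

lemma e_ideal_S: "e_ideal S = S"
  using e_ideal_subset[OF subalgebra_S] S_subset_e_ideal[OF subalgebra_S] by blast

end

text \<open>Each member serves as its own index. Directedness passes from the subalgebras
  \<open>B\<close> to their ideals because \<open>e_ideal\<close> is monotone.\<close>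

lemma (in simple_locally_finite_algebra) conical_local_system_of_dual_system:
  assumes "dual_system h N v w" "N > 0"
  obtains \<Gamma> :: "'a set set" and T where "conical_local_system \<Gamma> (\<lambda>B. B) T" "N \<le> rank T"
proof -
  interpret matrix_units scale h N v w by unfold_locales fact+
  define \<Gamma> where "\<Gamma> = {e_ideal B | B. subalgebra B \<and> fin_dim B \<and> S \<subseteq> B}"
  have \<Gamma>I: "e_ideal B \<in> \<Gamma>" if "subalgebra B" "fin_dim B" "S \<subseteq> B" for B using that \<Gamma>_def by blast
  have "local_system \<Gamma> (\<lambda>B. B)"
    unfolding local_system_def
  proof (intro conjI ballI)
    fix C assume "C \<in> \<Gamma>"
    then obtain B where B: "C = e_ideal B" "subalgebra B" "fin_dim B" "S \<subseteq> B" by (auto simp: \<Gamma>_def)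
    show "subalgebra C" using B subalgebra_e_ideal by simp
    then show "fin_dim C" using B e_ideal_subset fin_dim_mono subalgebraD(1) by metis
  next
    have "\<exists>C\<in>\<Gamma>. z \<in> C" for z
    proof -
      \<comment> \<open>Starting from \<open>S\<close> keeps \<open>S\<close> inside the subalgebra
        that catches \<open>z\<close>.\<close>
      obtain B where B: "subalgebra B" "fin_dim B" "S \<subseteq> B"
        "z \<in> span {x * e * y | x y. x \<in> B \<and> y \<in> B}"
        by (rule in_local_two_sided_span[OF e(3) fin_dim_S])
      then have "z \<in> e_ideal B" by (simp add: e_ideal_def)
      then show ?thesis using \<Gamma>I[OF B(1-3)] by blast
    qed
    then show "(\<Union>C\<in>\<Gamma>. C) = UNIV" by blast
  next
    fix C D assume "C \<in> \<Gamma>" "D \<in> \<Gamma>"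
    then obtain B B' where B: "C = e_ideal B" "fin_dim B" "S \<subseteq> B" "D = e_ideal B'" "fin_dim B'" "S \<subseteq> B'"
      by (auto simp: \<Gamma>_def)
    obtain B'' where B'': "subalgebra B''" "fin_dim B''" "B \<subseteq> B''" "B' \<subseteq> B''"
      using fin_dim_subalgebras_directed[OF B(2,5)] by blast
    have "S \<subseteq> B''" using B(3) B''(3) by (rule subset_trans)
    then have "e_ideal B'' \<in> \<Gamma>" by (rule \<Gamma>I[OF B''(1,2)])
    moreover have "C \<subseteq> e_ideal B''" "D \<subseteq> e_ideal B''"
      using B''(3,4)[THEN e_ideal_mono] B(1,4) by simp_all
    ultimately show "\<exists>C'\<in>\<Gamma>. C \<subseteq> C' \<and> D \<subseteq> C'" by blast
  qed
  moreover have "S \<in> \<Gamma>" using \<Gamma>I[OF subalgebra_S fin_dim_S] e_ideal_S by simp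
  moreover have "perfect C" "S \<subseteq> C" "\<And>n \<rho>. natural_module C n \<rho> \<Longrightarrow> has_nontrivial_factor S n \<rho>"
    if "C \<in> \<Gamma>" for C
    using that perfect_e_ideal S_subset_e_ideal e_ideal_nontrivial_factor by (auto simp: \<Gamma>_def)
  ultimately have "conical_local_system \<Gamma> (\<lambda>B. B) S"
    using simple_S by (auto simp: conical_local_system_def perfect_local_system_def)
  then show thesis using that rank_S by blast
qed

theorem theorem5p8:
  fixes scale :: "'f::alg_closed_field \<Rightarrow> 'a::ring \<Rightarrow> 'a"
  assumes "assoc_algebra scale"
    and "assoc_algebra.countably_infinite_dim scale"
    and "alg_simple (assoc_algebra.sub_alg scale UNIV)"
    and "assoc_algebra.locally_finite scale"
  shows "\<forall>N::nat. N > 0 \<longrightarrow>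
    (\<exists>(\<Gamma> :: 'a set set) (\<A> :: 'a set \<Rightarrow> 'a set) e.
       assoc_algebra.conical_local_system scale \<Gamma> \<A> e \<and>
       assoc_algebra.conical_rank scale \<A> e \<ge> N)"
proof (intro allI impI)
  fix N :: nat assume N: "N > 0"
  interpret assoc_algebra scale by fact
  interpret simple_locally_finite_algebra scale by unfold_locales fact+
  obtain X where X: "infinite X" "independent X" "span X = UNIV"
    using assms(2) by (auto simp: countably_infinite_dim_def)
  \<comment> \<open>Infinite dimension is what lets the scalar case extend a dual system
    forever.\<close>
  have "\<not> fin_dim UNIV"
  proof
    assume "fin_dim UNIV"
    then obtain Y where "finite Y" "span Y = UNIV" by (auto simp: fin_dim_def)
    then show False using independent_span_bound[of Y X] X by simp
  qed
  then obtain h v w where "dual_system h N v w"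
    using exists_dual_system alg_closed_imp_poly_has_root by blast
  then obtain \<Gamma> :: "'a set set" and T where "conical_local_system \<Gamma> (\<lambda>B. B) T" "N \<le> rank T"
    using conical_local_system_of_dual_system N by blast
  then show "\<exists>(\<Gamma> :: 'a set set) (\<A> :: 'a set \<Rightarrow> 'a set) e.
       conical_local_system \<Gamma> \<A> e \<and> conical_rank \<A> e \<ge> N"
    unfolding conical_rank_def by blast
qed

end
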